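(* Let $\mathcal{E}\subset\mathbb{R}^n$ be an ellipsoid. Given any positive integer $m$, let $B^{(m)}$ be the Bergman projection from $L^2(\mathcal{E})$ onto polyharmonic functions of order $m$. For each positive integer $N$, let $P_N$ be the space of real polynomials on $\mathcal{E}$ of degree at most $N$, and let $\mathcal{H}^{(m)}_N$ be the space of real polynomials of total degree at most $N$ that are polyharmonic of order $m$. Then, for each positive integer $N$, $B^{(m)}(P_N)=\mathcal{H}^{(m)}_N$.
   Context: An ellipsoid in $\mathbb{R}^n$ is the image of the open unit ball under an invertible real affine map; equivalently, a bounded domain $\{r<0\}$ with $r$ a real polynomial of degree $2$ with positive definite quadratic part, vanishing on the boundary. For a positive integer $m$, a function $f$ on a domain is polyharmonic of order $m$ if $\Delta^m f=0$, where $\Delta$ is the Laplacian. Here $L^2(\mathcal{E})$ is the real Hilbert space of real-valued functions square-integrable with respect to Lebesgue measure. The functions in $L^2(\mathcal{E})$ that are polyharmonic of order $m$ form a closed subspace, and $B^{(m)}$, the Bergman projection onto polyharmonic functions of order $m$, is the orthogonal projection of $L^2(\mathcal{E})$ onto this subspace. Polynomials are viewed as functions on $\mathcal{E}$. *)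

theory Defs
  imports "HOL-Analysis.Analysis"
begin

definition ellipsoid :: "(real ^ 'n) set \<Rightarrow> bool" where
  "ellipsoid E \<longleftrightarrow>
     (\<exists>(A :: real ^ 'n ^ 'n) b. invertible A \<and> E = (\<lambda>x. A *v x + b) ` ball 0 1)"

text \<open>
  A function on a set \<open>E\<close> is encoded as an element of \<open>extensional E\<close>.
  The differential operators below use \<open>at x\<close>, so at points of an open \<open>E\<close>
  they depend only on the values on \<open>E\<close>.
\<close>

definition partial_derivative :: "'n \<Rightarrow> (real ^ 'n \<Rightarrow> real) \<Rightarrow> real ^ 'n \<Rightarrow> real" where
  "partial_derivative i f = (\<lambda>x. frechet_derivative f (at x) (axis i 1))"

definition laplacian :: "(real ^ 'n \<Rightarrow> real) \<Rightarrow> real ^ 'n \<Rightarrow> real" where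
  "laplacian f = (\<lambda>x. \<Sum>i\<in>UNIV. partial_derivative i (partial_derivative i f) x)"

text \<open>\<open>k\<close> times continuously differentiable; meant for open \<open>S\<close>.\<close>

fun Ck_on :: "nat \<Rightarrow> (real ^ 'n) set \<Rightarrow> (real ^ 'n \<Rightarrow> real) \<Rightarrow> bool" where
  "Ck_on 0 S f \<longleftrightarrow> continuous_on S f"
| "Ck_on (Suc k) S f \<longleftrightarrow>
     f differentiable_on S \<and> (\<forall>i. Ck_on k S (partial_derivative i f))"

text \<open>
  The classical notion of a solution of \<open>\<Delta>\<^sup>m f = 0\<close>. The regularity requirement is
  needed because \<^const>\<open>frechet_derivative\<close> is total and has arbitrary values
  where the derivative does not exist.
\<close>

definition polyharmonic_on :: "nat \<Rightarrow> (real ^ 'n) set \<Rightarrow> (real ^ 'n \<Rightarrow> real) \<Rightarrow> bool" where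
  "polyharmonic_on m S f \<longleftrightarrow> Ck_on (2 * m) S f \<and> (\<forall>x\<in>S. (laplacian ^^ m) f x = 0)"

definition L2_on :: "(real ^ 'n) set \<Rightarrow> (real ^ 'n \<Rightarrow> real) set" where
  "L2_on E = {f \<in> extensional E. f \<in> borel_measurable (lebesgue_on E) \<and>
                integrable (lebesgue_on E) (\<lambda>x. (f x)\<^sup>2)}"

definition L2_inner :: "(real ^ 'n) set \<Rightarrow> (real ^ 'n \<Rightarrow> real) \<Rightarrow> (real ^ 'n \<Rightarrow> real) \<Rightarrow> real" where
  "L2_inner E f g = integral\<^sup>L (lebesgue_on E) (\<lambda>x. f x * g x)"

definition polyharmonic_L2 :: "nat \<Rightarrow> (real ^ 'n) set \<Rightarrow> (real ^ 'n \<Rightarrow> real) set" where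
  "polyharmonic_L2 m E = {f \<in> L2_on E. polyharmonic_on m E f}"

text \<open>
  The orthogonal projection of \<open>L\<^sup>2(E)\<close> onto \<^term>\<open>polyharmonic_L2 m E\<close>. Elements of
  \<^term>\<open>L2_on E\<close> are functions, not classes modulo null sets; since polyharmonic functions
  are continuous on the open set \<open>E\<close>, a class contains at most one of them, so the
  projection is unique as a function on \<open>E\<close>, and it depends only on the class of \<open>f\<close>.
\<close>

definition bergman_projection ::
  "nat \<Rightarrow> (real ^ 'n) set \<Rightarrow> (real ^ 'n \<Rightarrow> real) \<Rightarrow> real ^ 'n \<Rightarrow> real" where
  "bergman_projection m E f =
     (THE g. g \<in> polyharmonic_L2 m E \<and>
             (\<forall>h \<in> polyharmonic_L2 m E. L2_inner E (\<lambda>x. f x - g x) h = 0))"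

definition polynomial_deg_le :: "nat \<Rightarrow> (real ^ 'n \<Rightarrow> real) \<Rightarrow> bool" where
  "polynomial_deg_le N p \<longleftrightarrow>
     (\<exists>c :: ('n \<Rightarrow> nat) \<Rightarrow> real.
        p = (\<lambda>x. \<Sum>\<alpha> | (\<Sum>i\<in>UNIV. \<alpha> i) \<le> N. c \<alpha> * (\<Prod>i\<in>UNIV. (x $ i) ^ \<alpha> i)))"

definition polynomials_on :: "nat \<Rightarrow> (real ^ 'n) set \<Rightarrow> (real ^ 'n \<Rightarrow> real) set" where
  "polynomials_on N E = {restrict p E | p. polynomial_deg_le N p}"

definition polyharmonic_polynomials_on ::
  "nat \<Rightarrow> nat \<Rightarrow> (real ^ 'n) set \<Rightarrow> (real ^ 'n \<Rightarrow> real) set" where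
  "polyharmonic_polynomials_on m N E = {p \<in> polynomials_on N E. polyharmonic_on m E p}"

text \<open>The index set of the sum in \<^const>\<open>polynomial_deg_le\<close> is finite.\<close>

lemma finite_multi_indices_le:
  "finite {\<alpha> :: 'n::finite \<Rightarrow> nat. (\<Sum>i\<in>UNIV. \<alpha> i) \<le> N}"
proof (rule finite_subset)
  show "{\<alpha> :: 'n \<Rightarrow> nat. (\<Sum>i\<in>UNIV. \<alpha> i) \<le> N} \<subseteq> Pi\<^sub>E UNIV (\<lambda>_. {..N})"
  proof
    fix \<alpha> :: "'n \<Rightarrow> nat" assume "\<alpha> \<in> {\<alpha>. (\<Sum>i\<in>UNIV. \<alpha> i) \<le> N}"
    then have "\<alpha> i \<le> N" for i
      using member_le_sum[of i UNIV \<alpha>] by fastforce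
    then show "\<alpha> \<in> Pi\<^sub>E UNIV (\<lambda>_. {..N})" by auto
  qed
qed (auto intro: finite_PiE)

end

theory Submission
  imports Defs
begin

text \<open>
  Write \<open>E = {s > 0}\<close> with \<open>s\<close> a polynomial of degree 2, and let \<open>V\<close> be the finite-dimensional space
  of the polynomials \<open>\<Delta>\<^sup>m (s\<^sup>2\<^sup>m q)\<close> with \<open>deg q \<le> N - 2m\<close>, so that \<open>V\<close> consists of polynomials of
  degree at most \<open>N\<close>. Since \<open>s\<^sup>2\<^sup>m\<close> vanishes to order \<open>2m\<close> on the boundary, Green's formula shows
  that \<open>V\<close> is orthogonal to every square-integrable polyharmonic function of order \<open>m\<close>.
  For \<open>p\<close> of degree at most \<open>N\<close> let \<open>h\<close> be \<open>p\<close> minus its orthogonal projection to \<open>V\<close>.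
  Then \<open>\<integral> s\<^sup>2\<^sup>m q \<Delta>\<^sup>m h = \<integral> h \<Delta>\<^sup>m (s\<^sup>2\<^sup>m q) = 0\<close> for all such \<open>q\<close>, and \<open>q = \<Delta>\<^sup>m h\<close> gives \<open>\<Delta>\<^sup>m h = 0\<close>.
  Hence \<open>h\<close> is the Bergman projection of \<open>p\<close>.
\<close>

section \<open>Partial derivatives and the classes \<open>C\<^sup>k\<close>\<close>

lemma partial_derivative_eqI:
  "(f has_derivative f') (at x) \<Longrightarrow> partial_derivative i f x = f' (axis i 1)"
  unfolding partial_derivative_def by (metis frechet_derivative_at)

lemma partial_derivative_add:
  assumes "f differentiable at x" "g differentiable at x"
  shows "partial_derivative i (\<lambda>x. f x + g x) x = partial_derivative i f x + partial_derivative i g x"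
proof -
  from assms obtain f' g' where *: "(f has_derivative f') (at x)" "(g has_derivative g') (at x)"
    unfolding differentiable_def by blast
  show ?thesis
    using partial_derivative_eqI[OF has_derivative_add[OF *]] * by (simp add: partial_derivative_eqI)
qed

lemma partial_derivative_mult:
  assumes "f differentiable at x" "g differentiable at x"
  shows "partial_derivative i (\<lambda>x. f x * g x) x =
    f x * partial_derivative i g x + partial_derivative i f x * g x"
proof -
  from assms obtain f' g' where *: "(f has_derivative f') (at x)" "(g has_derivative g') (at x)"
    unfolding differentiable_def by blast
  show ?thesis
    using partial_derivative_eqI[OF has_derivative_mult[OF *]] * by (simp add: partial_derivative_eqI)
qed

lemma partial_derivative_const: "partial_derivative i (\<lambda>x. c) = (\<lambda>x. 0)"
  by (intro ext partial_derivative_eqI[OF has_derivative_const, THEN trans]) simp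

lemma has_derivative_component: "((\<lambda>x::real^'n. x $ j) has_derivative (\<lambda>x. x $ j)) (at x)"
  by (intro bounded_linear.has_derivative[OF bounded_linear_vec_nth] has_derivative_ident)

lemma partial_derivative_component:
  "partial_derivative i (\<lambda>x. x $ j) = (\<lambda>x. if i = j then 1 else 0)"
  by (intro ext partial_derivative_eqI[OF has_derivative_component, THEN trans]) (simp add: axis_def)

lemma differentiable_cong_open:
  assumes "open S" "x \<in> S" "\<And>y. y \<in> S \<Longrightarrow> f y = g y" "f differentiable at x"
  shows "g differentiable at x"
  using assms unfolding differentiable_def by (metis has_derivative_transform_within_open)

text \<open>A map is a derivative of \<open>f\<close> at \<open>x\<close> exactly if it is one of
  \<open>g\<close>, so the choice made by \<open>frechet_derivative\<close> agrees, even at points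
  where no derivative exists.\<close>

lemma partial_derivative_cong_open:
  assumes "open S" "x \<in> S" "\<And>y. y \<in> S \<Longrightarrow> f y = g y"
  shows "partial_derivative i f x = partial_derivative i g x"
proof -
  have "(f has_derivative f') (at x) \<longleftrightarrow> (g has_derivative f') (at x)" for f'
    using assms by (metis has_derivative_transform_within_open)
  then show ?thesis
    unfolding partial_derivative_def frechet_derivative_def by simp
qed

lemma laplacian_cong_open:
  assumes "open S" "x \<in> S" "\<And>y. y \<in> S \<Longrightarrow> f y = g y"
  shows "laplacian f x = laplacian g x"
  unfolding laplacian_def
  by (intro sum.cong refl partial_derivative_cong_open[OF assms(1,2)])
     (use assms partial_derivative_cong_open in blast)

lemma laplacian_power_cong_open:
  assumes "open S" "x \<in> S" "\<And>y. y \<in> S \<Longrightarrow> f y = g y"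
  shows "(laplacian ^^ m) f x = (laplacian ^^ m) g x"
  using assms(2)
proof (induction m arbitrary: x)
  case (Suc m)
  then show ?case
    using laplacian_cong_open[OF assms(1), of x "(laplacian ^^ m) f" "(laplacian ^^ m) g"] by simp
qed (use assms in simp)

lemma Ck_on_SucD: "Ck_on (Suc k) S f \<Longrightarrow> Ck_on k S f"
  by (induction k arbitrary: f) (auto intro: differentiable_imp_continuous_on)

lemma Ck_on_mono:
  assumes "Ck_on k S f" "l \<le> k"
  shows "Ck_on l S f"
  using assms(2,1)
proof (induction k rule: dec_induct)
  case (step k)
  then show ?case by (blast intro: Ck_on_SucD[of k])
qed

lemma Ck_on_imp_continuous_on: "Ck_on k S f \<Longrightarrow> continuous_on S f"
  using Ck_on_mono[of k S f 0] by simp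

text \<open>The sum rule for derivatives is available only on \<open>S\<close>, while
  \<open>partial_derivative\<close> yields functions on the whole space; regularity is carried
  across such identities here.\<close>

lemma Ck_on_cong:
  assumes "open S" "Ck_on k S f" "\<And>x. x \<in> S \<Longrightarrow> f x = g x"
  shows "Ck_on k S g"
  using assms(2,3)
proof (induction k arbitrary: f g)
  case 0
  then show ?case using continuous_on_cong by (metis Ck_on.simps(1))
next
  case (Suc k)
  have "g differentiable_on S"
    using Suc.prems assms(1) differentiable_cong_open[OF assms(1), of _ f g]
    by (auto simp: differentiable_on_eq_differentiable_at)
  moreover have "Ck_on k S (partial_derivative i g)" for i
  proof (rule Suc.IH)
    show "Ck_on k S (partial_derivative i f)" using Suc.prems by simp
    show "partial_derivative i f x = partial_derivative i g x" if "x \<in> S" for x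
      using assms(1) that Suc.prems(2) by (rule partial_derivative_cong_open)
  qed
  ultimately show ?case by simp
qed

lemma Ck_on_add:
  assumes "open S" "Ck_on k S f" "Ck_on k S g"
  shows "Ck_on k S (\<lambda>x. f x + g x)"
  using assms(2,3)
proof (induction k arbitrary: f g)
  case 0
  then show ?case by (auto intro: continuous_intros)
next
  case (Suc k)
  have *: "Ck_on k S (\<lambda>x. partial_derivative i f x + partial_derivative i g x)" for i
    using Suc by auto
  have "Ck_on k S (partial_derivative i (\<lambda>x. f x + g x))" for i
    by (rule Ck_on_cong[OF assms(1) *])
       (use Suc.prems assms(1) in
         \<open>auto simp: differentiable_on_eq_differentiable_at partial_derivative_add\<close>)
  then show ?case using Suc.prems by (auto simp: differentiable_on_def)
qed

lemma Ck_on_const: "Ck_on k S (\<lambda>x. c)"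
  by (induction k arbitrary: c) (auto simp: partial_derivative_const)

lemma Ck_on_sum:
  assumes "open S" "finite I" "\<And>i. i \<in> I \<Longrightarrow> Ck_on k S (f i)"
  shows "Ck_on k S (\<lambda>x. \<Sum>i\<in>I. f i x)"
  using assms(2,3) by (induction I rule: finite_induct) (auto simp: Ck_on_const Ck_on_add[OF assms(1)])

lemma Ck_on_laplacian:
  assumes "open S" "Ck_on (Suc (Suc k)) S f"
  shows "Ck_on k S (laplacian f)"
  unfolding laplacian_def using assms by (intro Ck_on_sum) auto

text \<open>Lets a polynomial be replaced by its restriction to \<open>S\<close>, the form in which
  elements of \<open>L2_on\<close> are encoded.\<close>

lemma polyharmonic_on_cong:
  assumes "open S" "\<And>x. x \<in> S \<Longrightarrow> f x = g x" "polyharmonic_on m S f"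
  shows "polyharmonic_on m S g"
  using assms Ck_on_cong[OF assms(1), of "2 * m" f g] laplacian_power_cong_open[OF assms(1), of _ f g m]
  unfolding polyharmonic_on_def by auto

section \<open>Polynomial functions\<close>

text \<open>\<open>polyfun k f\<close>: \<open>f\<close> is a polynomial of degree less than \<open>k\<close>. The strict bound makes
  \<open>polyfun 0\<close> the zero polynomial, so truncated subtraction gives the right degrees of derivatives.\<close>

inductive polyfun :: "nat \<Rightarrow> (real ^ 'n \<Rightarrow> real) \<Rightarrow> bool" where
  zero: "polyfun k (\<lambda>x. 0)"
| const: "polyfun (Suc k) (\<lambda>x. c)"
| var: "polyfun k f \<Longrightarrow> polyfun (Suc k) (\<lambda>x. x $ i * f x)"
| add: "polyfun k f \<Longrightarrow> polyfun k g \<Longrightarrow> polyfun k (\<lambda>x. f x + g x)"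

lemma polyfun_0D: "polyfun 0 f \<Longrightarrow> f = (\<lambda>x. 0)"
  by (induction "0::nat" f rule: polyfun.induct) auto

lemma polyfun_mono: "polyfun k f \<Longrightarrow> k \<le> l \<Longrightarrow> polyfun l f"
proof (induction arbitrary: l rule: polyfun.induct)
  case (const k c)
  then show ?case by (cases l) (auto intro: polyfun.intros)
next
  case (var k f i)
  then show ?case by (cases l) (auto intro: polyfun.intros)
qed (auto intro: polyfun.intros)

lemma polyfun_cmult: "polyfun k f \<Longrightarrow> polyfun k (\<lambda>x. c * f x)"
proof (induction rule: polyfun.induct)
  case (var k f i)
  then show ?case using polyfun.var[of k "\<lambda>x. c * f x" i] by (simp add: mult.left_commute)
qed (auto intro: polyfun.intros simp: distrib_left)

text \<open>Degrees at most \<open>k - 1\<close> and \<open>l - 1\<close> add up to less than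
  \<open>k - 1 + l\<close>; if \<open>k = 0\<close> the product is zero.\<close>

lemma polyfun_mult: "polyfun k f \<Longrightarrow> polyfun l g \<Longrightarrow> polyfun (k - 1 + l) (\<lambda>x. f x * g x)"
proof (induction rule: polyfun.induct)
  case (const k c)
  then show ?case using polyfun_mono[OF polyfun_cmult, of l g "k + l" c] by simp
next
  case (var k f i)
  show ?case
  proof (cases k)
    \<comment> \<open>For \<open>k = 0\<close> the rule \<open>polyfun.var\<close> would give a
      bound one too high, but here \<open>f\<close> is zero.\<close>
    case 0
    then show ?thesis using var polyfun_0D[of f] by (simp add: polyfun.zero)
  next
    case (Suc k')
    then show ?thesis
      using polyfun.var[of "k' + l" "\<lambda>x. f x * g x" i] var by (simp add: mult.assoc)
  qed
qed (auto intro: polyfun.intros simp: distrib_right)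

lemma polyfun_sum:
  "finite I \<Longrightarrow> (\<And>i. i \<in> I \<Longrightarrow> polyfun k (f i)) \<Longrightarrow> polyfun k (\<lambda>x. \<Sum>i\<in>I. f i x)"
  by (induction I rule: finite_induct) (auto intro: polyfun.intros)

lemma polyfun_diff: "polyfun k f \<Longrightarrow> polyfun k g \<Longrightarrow> polyfun k (\<lambda>x. f x - g x)"
  using polyfun.add[of k f "\<lambda>x. -1 * g x"] polyfun_cmult[of k g "-1"] by simp

lemma polyfun_power: "polyfun (Suc k) f \<Longrightarrow> polyfun (Suc (k * j)) (\<lambda>x. f x ^ j)"
proof (induction j)
  case 0
  show ?case using polyfun.const[of 0 1] by simp
next
  case (Suc j)
  then show ?case using polyfun_mult[of "Suc k" f "Suc (k * j)" "\<lambda>x. f x ^ j"] by simp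
qed

lemma polyfun_differentiable: "polyfun k f \<Longrightarrow> f differentiable at x"
  by (induction rule: polyfun.induct)
     (auto intro!: derivative_intros has_derivative_component[THEN differentiableI])

lemma polyfun_partial_derivative: "polyfun k f \<Longrightarrow> polyfun (k - 1) (partial_derivative i f)"
proof (induction rule: polyfun.induct)
  case (var k f j)
  have eq: "partial_derivative i (\<lambda>x. x $ j * f x) =
    (\<lambda>x. x $ j * partial_derivative i f x + (if i = j then 1 else 0) * f x)"
    using partial_derivative_mult[OF has_derivative_component[THEN differentiableI]
        polyfun_differentiable[OF var.hyps]]
    by (simp add: fun_eq_iff partial_derivative_component)
  show ?case
  proof (cases k)
    case 0
    then have "f = (\<lambda>x. 0)" using var.hyps polyfun_0D by blast
    then show ?thesis by (simp add: partial_derivative_const polyfun.zero)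
  next
    case (Suc k')
    then show ?thesis
      unfolding eq using var by (intro polyfun.add polyfun_cmult) (auto intro: polyfun.var)
  qed
next
  case (add k f g)
  then have "partial_derivative i (\<lambda>x. f x + g x) =
    (\<lambda>x. partial_derivative i f x + partial_derivative i g x)"
    by (intro ext partial_derivative_add polyfun_differentiable)
  then show ?case using add by (simp add: polyfun.add)
qed (auto simp: partial_derivative_const polyfun.zero)

lemma polyfun_continuous_on: "polyfun k f \<Longrightarrow> continuous_on S f"
  by (meson polyfun_differentiable differentiable_imp_continuous_within
      continuous_at_imp_continuous_on)

lemma polyfun_laplacian:
  assumes "polyfun k f" shows "polyfun (k - 2) (laplacian f)"
proof -
  have "polyfun (k - 2) (partial_derivative i (partial_derivative i f))" for i
    using polyfun_partial_derivative[OF polyfun_partial_derivative[OF assms, of i], of i]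
    by (simp add: numeral_2_eq_2)
  then show ?thesis unfolding laplacian_def by (intro polyfun_sum) auto
qed

lemma polyfun_laplacian_power: "polyfun k f \<Longrightarrow> polyfun (k - 2 * m) ((laplacian ^^ m) f)"
proof (induction m)
  case (Suc m)
  then show ?case using polyfun_laplacian[of "k - 2 * m" "(laplacian ^^ m) f"] by simp
qed simp

lemma polyfun_Ck_on: "polyfun k f \<Longrightarrow> Ck_on l S f"
  by (induction l arbitrary: k f)
     (auto simp: polyfun_continuous_on differentiable_on_def
       intro: differentiable_at_withinI polyfun_differentiable polyfun_partial_derivative)

section \<open>Linearity of the iterated Laplacian on polynomials\<close>

lemma laplacian_add:
  assumes "polyfun k f" "polyfun l g"
  shows "laplacian (\<lambda>x. f x + g x) = (\<lambda>x. laplacian f x + laplacian g x)"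
proof -
  have *: "partial_derivative i (\<lambda>x. f x + g x) =
      (\<lambda>x. partial_derivative i f x + partial_derivative i g x)"
    if "polyfun k f" "polyfun l g" for k l f g i
    using that by (intro ext partial_derivative_add polyfun_differentiable)
  show ?thesis
    unfolding laplacian_def *[OF assms]
      *[OF polyfun_partial_derivative[OF assms(1)] polyfun_partial_derivative[OF assms(2)]]
    by (simp add: sum.distrib)
qed

lemma partial_derivative_cmult:
  "f differentiable at x \<Longrightarrow> partial_derivative i (\<lambda>x. c * f x) x = c * partial_derivative i f x"
  using partial_derivative_mult[of "\<lambda>x. c" x f i] by (simp add: partial_derivative_const)

lemma laplacian_cmult:
  assumes "polyfun k f"
  shows "laplacian (\<lambda>x. c * f x) = (\<lambda>x. c * laplacian f x)"
proof -
  have *: "partial_derivative i (\<lambda>x. c * f x) = (\<lambda>x. c * partial_derivative i f x)"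
    if "polyfun k f" for k f i
    using that by (intro ext partial_derivative_cmult polyfun_differentiable)
  show ?thesis
    unfolding laplacian_def *[OF assms] *[OF polyfun_partial_derivative[OF assms]]
    by (simp add: sum_distrib_left)
qed

lemma laplacian_power_add:
  assumes "polyfun k f" "polyfun l g"
  shows "(laplacian ^^ m) (\<lambda>x. f x + g x) = (\<lambda>x. (laplacian ^^ m) f x + (laplacian ^^ m) g x)"
  by (induction m)
     (simp_all add: laplacian_add[OF polyfun_laplacian_power[OF assms(1)]
         polyfun_laplacian_power[OF assms(2)]])

lemma laplacian_power_cmult:
  assumes "polyfun k f"
  shows "(laplacian ^^ m) (\<lambda>x. c * f x) = (\<lambda>x. c * (laplacian ^^ m) f x)"
  by (induction m) (simp_all add: laplacian_cmult[OF polyfun_laplacian_power[OF assms]])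

lemma laplacian_power_zero: "(laplacian ^^ m) (\<lambda>x. 0) = (\<lambda>x. 0)"
  by (induction m) (simp_all add: laplacian_def partial_derivative_const)

lemma laplacian_power_sum:
  assumes "finite I" "\<And>i. i \<in> I \<Longrightarrow> polyfun k (f i)"
  shows "(laplacian ^^ m) (\<lambda>x. \<Sum>i\<in>I. a i * f i x) = (\<lambda>x. \<Sum>i\<in>I. a i * (laplacian ^^ m) (f i) x)"
  using assms
proof (induction I rule: finite_induct)
  case (insert j I)
  have *: "polyfun k (\<lambda>x. \<Sum>i\<in>I. a i * f i x)" "polyfun k (\<lambda>x. a j * f j x)"
    using insert.hyps insert.prems by (auto intro!: polyfun_sum polyfun_cmult)
  show ?case
    using insert laplacian_power_add[OF *(2,1), of m] laplacian_power_cmult[of k "f j" m "a j"] by simp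
qed (simp add: laplacian_power_zero)

section \<open>Monomials and coefficients\<close>

lemma polyfun_monomial_power: "polyfun k f \<Longrightarrow> polyfun (k + j) (\<lambda>x. (x $ i) ^ j * f x)"
proof (induction j)
  case (Suc j)
  then show ?case using polyfun.var[of "k + j" "\<lambda>x. (x $ i) ^ j * f x" i] by (simp add: mult.assoc)
qed simp

lemma polyfun_monomial:
  fixes \<alpha> :: "'n::finite \<Rightarrow> nat"
  shows "polyfun (Suc (\<Sum>i\<in>UNIV. \<alpha> i)) (\<lambda>x. \<Prod>i\<in>UNIV. (x $ i) ^ \<alpha> i)"
proof -
  have "polyfun (Suc (\<Sum>i\<in>I. \<alpha> i)) (\<lambda>x. \<Prod>i\<in>I. (x $ i) ^ \<alpha> i)" for I
  proof (induction I rule: finite_induct[OF finite])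
    case 1
    show ?case using polyfun.const[of 0 1] by simp
  next
    case (2 j I)
    then show ?case
      using polyfun_monomial_power[of "Suc (sum \<alpha> I)" "\<lambda>x. \<Prod>i\<in>I. (x $ i) ^ \<alpha> i" "\<alpha> j" j]
      by (simp add: add.commute)
  qed
  then show ?thesis .
qed

lemma finite_multi_indices_less: "finite {\<alpha> :: 'n::finite \<Rightarrow> nat. (\<Sum>i\<in>UNIV. \<alpha> i) < k}"
  by (rule finite_subset[OF _ finite_multi_indices_le[of k]]) auto

text \<open>Passes from the inductive description to coefficients, by induction on the rules. The
  case with content is multiplication by a variable, which shifts exponents.\<close>

lemma polyfun_expansion:
  fixes f :: "real ^ 'n \<Rightarrow> real"
  assumes "polyfun k f"
  obtains c where "f = (\<lambda>x. \<Sum>\<alpha> | (\<Sum>i\<in>UNIV. \<alpha> i) < k. c \<alpha> * (\<Prod>i\<in>UNIV. (x $ i) ^ \<alpha> i))"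
proof -
  define M :: "('n \<Rightarrow> nat) \<Rightarrow> real ^ 'n \<Rightarrow> real" where "M = (\<lambda>\<alpha> x. \<Prod>i\<in>UNIV. (x $ i) ^ \<alpha> i)"
  have "\<exists>c. f = (\<lambda>x. \<Sum>\<alpha> | (\<Sum>i\<in>UNIV. \<alpha> i) < k. c \<alpha> * M \<alpha> x)"
    using assms
  proof (induction rule: polyfun.induct)
    case (zero k)
    show ?case by (rule exI[of _ "\<lambda>_. 0"]) simp
  next
    case (const k c)
    have "(\<Sum>\<alpha> | (\<Sum>i\<in>UNIV. \<alpha> i) < Suc k. (if \<alpha> = (\<lambda>_. 0) then c else 0) * M \<alpha> x) = c" for x
      using finite_multi_indices_less[where 'n='n and k="Suc k"]
      by (simp add: if_distrib[of "\<lambda>t. t * _"] sum.delta' cong: if_cong) (simp add: M_def)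
    then show ?case by (intro exI[of _ "\<lambda>\<alpha>. if \<alpha> = (\<lambda>_. 0) then c else 0"]) simp
  next
    case (var k f j)
    then obtain c where c: "f = (\<lambda>x. \<Sum>\<alpha> | (\<Sum>i\<in>UNIV. \<alpha> i) < k. c \<alpha> * M \<alpha> x)" by blast
    \<comment> \<open>\<open>up\<close> and \<open>dn\<close> are inverse bijections between the
      indices of total degree below \<open>k\<close> and those of total degree below
      \<open>Suc k\<close> with a positive exponent at \<open>j\<close>.\<close>
    define up :: "('n \<Rightarrow> nat) \<Rightarrow> 'n \<Rightarrow> nat" where "up = (\<lambda>\<alpha>. \<alpha>(j := Suc (\<alpha> j)))"
    define dn :: "('n \<Rightarrow> nat) \<Rightarrow> 'n \<Rightarrow> nat" where "dn = (\<lambda>\<alpha>. \<alpha>(j := \<alpha> j - 1))"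
    have sum_up: "(\<Sum>i\<in>UNIV. up \<alpha> i) = Suc (\<Sum>i\<in>UNIV. \<alpha> i)" for \<alpha>
      unfolding up_def by (simp add: sum.remove[of UNIV j])
    have M_up: "M (up \<alpha>) x = x $ j * M \<alpha> x" for \<alpha> x
      unfolding M_def up_def by (simp add: prod.remove[of UNIV j])
    have up_dn: "up (dn \<alpha>) = \<alpha>" if "\<alpha> j > 0" for \<alpha> using that by (auto simp: up_def dn_def)
    have sum_dn: "(\<Sum>i\<in>UNIV. \<alpha> i) = Suc (\<Sum>i\<in>UNIV. dn \<alpha> i)" if "\<alpha> j > 0" for \<alpha>
      using sum_up[of "dn \<alpha>"] up_dn[of \<alpha>] that by simp
    have up_pos: "up \<alpha> j > 0" for \<alpha> by (simp add: up_def)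
    have dn_up: "dn (up \<alpha>) = \<alpha>" for \<alpha> by (auto simp: up_def dn_def)
    have "x $ j * f x = (\<Sum>\<alpha> | (\<Sum>i\<in>UNIV. \<alpha> i) < Suc k. (if \<alpha> j > 0 then c (dn \<alpha>) else 0) * M \<alpha> x)" for x
    proof -
      have "x $ j * f x = (\<Sum>\<alpha> | (\<Sum>i\<in>UNIV. \<alpha> i) < k. c \<alpha> * M (up \<alpha>) x)"
        unfolding c M_up by (simp add: sum_distrib_left mult.left_commute)
      also have "\<dots> = (\<Sum>\<alpha> | (\<Sum>i\<in>UNIV. \<alpha> i) < Suc k \<and> \<alpha> j > 0. c (dn \<alpha>) * M \<alpha> x)"
        by (rule sum.reindex_bij_witness[of _ dn up])
           (auto simp: up_dn dn_up sum_up up_pos sum_dn)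
      also have "\<dots> = (\<Sum>\<alpha> | (\<Sum>i\<in>UNIV. \<alpha> i) < Suc k. (if \<alpha> j > 0 then c (dn \<alpha>) else 0) * M \<alpha> x)"
        by (rule sum.mono_neutral_cong_left[OF finite_multi_indices_less]) auto
      finally show ?thesis .
    qed
    then show ?case by (intro exI[of _ "\<lambda>\<alpha>. if \<alpha> j > 0 then c (dn \<alpha>) else 0"]) simp
  next
    case (add k f g)
    then obtain a b where "f = (\<lambda>x. \<Sum>\<alpha> | (\<Sum>i\<in>UNIV. \<alpha> i) < k. a \<alpha> * M \<alpha> x)"
      "g = (\<lambda>x. \<Sum>\<alpha> | (\<Sum>i\<in>UNIV. \<alpha> i) < k. b \<alpha> * M \<alpha> x)" by blast
    then show ?case
      by (intro exI[of _ "\<lambda>\<alpha>. a \<alpha> + b \<alpha>"]) (simp add: sum.distrib distrib_right)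
  qed
  with that show thesis unfolding M_def by blast
qed

text \<open>Ties the monomial sums of the statement to the inductive predicate; \<open>Suc N\<close>
  appears because \<open>polyfun\<close> bounds the degree strictly.\<close>

lemma polynomial_deg_le_iff_polyfun: "polynomial_deg_le N p \<longleftrightarrow> polyfun (Suc N) p"
proof
  assume "polynomial_deg_le N p"
  then obtain c where "p = (\<lambda>x. \<Sum>\<alpha> | (\<Sum>i\<in>UNIV. \<alpha> i) \<le> N. c \<alpha> * (\<Prod>i\<in>UNIV. (x $ i) ^ \<alpha> i))"
    unfolding polynomial_deg_le_def by blast
  then show "polyfun (Suc N) p"
    using polyfun_mono[OF polyfun_monomial, of _ "Suc N"]
    by (auto intro!: polyfun_sum polyfun_cmult finite_multi_indices_le)
next
  assume "polyfun (Suc N) p"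
  then show "polynomial_deg_le N p"
    by (elim polyfun_expansion) (auto simp: polynomial_deg_le_def less_Suc_eq_le)
qed

section \<open>Integration by parts on superlevel sets\<close>

text \<open>The chain rule along a coordinate line, which makes the mean value theorem of one
  variable applicable.\<close>

lemma has_real_derivative_partial_derivative:
  assumes "f differentiable at (x + t *\<^sub>R axis i 1)"
  shows "((\<lambda>t. f (x + t *\<^sub>R axis i 1)) has_real_derivative
    partial_derivative i f (x + t *\<^sub>R axis i 1)) (at t)"
proof -
  from assms obtain f' where f': "(f has_derivative f') (at (x + t *\<^sub>R axis i 1))"
    unfolding differentiable_def by blast
  have "((\<lambda>t. x + t *\<^sub>R axis i 1) has_derivative (\<lambda>t. t *\<^sub>R axis i 1)) (at t)"
    by (auto intro!: derivative_eq_intros)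
  from has_derivative_compose[OF this f'] show ?thesis
    unfolding has_field_derivative_def partial_derivative_eqI[OF f']
    by (simp add: linear_cmul[OF has_derivative_linear[OF f']] mult.commute[of _ "f' _"])
qed

text \<open>The limit is taken along a sequence of steps to fit dominated convergence.\<close>

lemma difference_quotient_tendsto:
  assumes "f differentiable at x"
  shows "(\<lambda>n. real (Suc n) * (f (x + (1 / real (Suc n)) *\<^sub>R axis i 1) - f x))
    \<longlonglongrightarrow> partial_derivative i f x"
proof -
  have "((\<lambda>t. f (x + t *\<^sub>R axis i 1)) has_real_derivative partial_derivative i f x) (at 0)"
    using has_real_derivative_partial_derivative[of f x 0 i] assms by simp
  then have "((\<lambda>h. (f (x + h *\<^sub>R axis i 1) - f x) / h) \<longlongrightarrow> partial_derivative i f x) (at 0)"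
    by (simp add: DERIV_def)
  moreover have "filterlim (\<lambda>n. 1 / real (Suc n)) (at 0) sequentially"
    unfolding filterlim_at using LIMSEQ_inverse_real_of_nat by (simp add: inverse_eq_divide)
  ultimately have "(\<lambda>n. (f (x + (1 / real (Suc n)) *\<^sub>R axis i 1) - f x) / (1 / real (Suc n)))
      \<longlonglongrightarrow> partial_derivative i f x"
    by (rule filterlim_compose)
  then show ?thesis by (simp add: mult.commute)
qed

lemma integral_translation_invariant:
  fixes f :: "'a::euclidean_space \<Rightarrow> real"
  assumes "f \<in> borel_measurable borel"
  shows "integral\<^sup>L lborel (\<lambda>x. f (x + c)) = integral\<^sup>L lborel f"
proof -
  have "integral\<^sup>L lborel f = integral\<^sup>L (distr lborel borel ((+) c)) f"
    by (simp add: lborel_distr_plus)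
  also have "\<dots> = integral\<^sup>L lborel (\<lambda>x. f (c + x))"
    using assms by (subst integral_distr) auto
  finally show ?thesis by (simp add: add.commute)
qed

lemma continuous_on_compact_bound:
  fixes f :: "'a::topological_space \<Rightarrow> real"
  assumes "compact K" "continuous_on K f"
  obtains B where "0 \<le> B" "\<And>x. x \<in> K \<Longrightarrow> \<bar>f x\<bar> \<le> B"
proof -
  have "bounded (f ` K)" using assms compact_continuous_image compact_imp_bounded by blast
  then obtain B where "\<And>x. x \<in> K \<Longrightarrow> \<bar>f x\<bar> \<le> B" unfolding bounded_iff by auto
  then show thesis using that[of "max B 0"] by force
qed

text \<open>Extended by zero, \<open>\<sigma> \<phi>\<close> is Lipschitz in direction \<open>i\<close>. By translation invariance its
  difference quotients have integral zero, and they converge boundedly to the partial derivative off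
  the null set \<open>{\<sigma> = 0}\<close>.\<close>

lemma integral_partial_derivative_eq_0:
  fixes \<sigma> \<phi> :: "real ^ 'n \<Rightarrow> real"
  assumes \<sigma>: "polyfun k \<sigma>"
    and K: "compact {x. 0 \<le> \<sigma> x}" "convex {x. 0 \<le> \<sigma> x}" "negligible {x. \<sigma> x = 0}"
    and W: "open W" "{x. 0 \<le> \<sigma> x} \<subseteq> W"
    and \<phi>: "\<phi> differentiable_on W" "continuous_on W (partial_derivative i \<phi>)"
  shows "integral\<^sup>L (lebesgue_on {x. 0 < \<sigma> x}) (partial_derivative i (\<lambda>x. \<sigma> x * \<phi> x)) = 0"
proof -
  define e :: "real ^ 'n" where "e = axis i 1"
  have norm_e: "norm e = 1" by (simp add: e_def)
  define \<psi> where "\<psi> = (\<lambda>x. \<sigma> x * \<phi> x)"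
  \<comment> \<open>\<open>F\<close> is continuous across the boundary because
    \<open>\<sigma>\<close> vanishes there, but it need not be differentiable; \<open>D\<close> is
    its derivative off the zero set of \<open>\<sigma>\<close>.\<close>
  define F where "F = (\<lambda>x. if 0 < \<sigma> x then \<psi> x else 0)"
  define D where "D = (\<lambda>x. if 0 < \<sigma> x then partial_derivative i \<psi> x else 0)"
  have \<sigma>_diff: "\<sigma> differentiable at x" for x using \<sigma> by (rule polyfun_differentiable)
  have \<sigma>_cont: "continuous_on S \<sigma>" for S using \<sigma> by (rule polyfun_continuous_on)
  have \<phi>_diff: "\<phi> differentiable at x" if "x \<in> W" for x
    using \<phi>(1) W(1) that by (simp add: differentiable_on_eq_differentiable_at)
  have \<psi>_diff: "\<psi> differentiable at x" if "x \<in> W" for x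
    unfolding \<psi>_def using \<sigma>_diff \<phi>_diff[OF that] by (intro differentiable_mult)
  have \<phi>_cont: "continuous_on W \<phi>" using \<phi>(1) by (rule differentiable_imp_continuous_on)
  have "continuous_on W (\<lambda>x. \<sigma> x * partial_derivative i \<phi> x + partial_derivative i \<sigma> x * \<phi> x)"
    using \<phi>(2) \<phi>_cont \<sigma>_cont polyfun_continuous_on[OF polyfun_partial_derivative[OF \<sigma>]]
    by (intro continuous_intros)
  then have D\<psi>_cont: "continuous_on W (partial_derivative i \<psi>)"
    by (rule continuous_on_eq) (simp add: \<psi>_def partial_derivative_mult \<sigma>_diff \<phi>_diff)
  have \<psi>_cont: "continuous_on W \<psi>"
    unfolding \<psi>_def using \<sigma>_cont \<phi>_cont by (intro continuous_intros)
  have openU: "open {x. 0 < \<sigma> x}" using \<sigma>_cont by (intro open_Collect_less continuous_intros)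
  have openL: "open {x. \<sigma> x < 0}" using \<sigma>_cont by (intro open_Collect_less continuous_intros)
  have U_W: "{x. 0 < \<sigma> x} \<subseteq> W" using W(2) by auto
  obtain B where B: "0 \<le> B" "\<And>x. 0 \<le> \<sigma> x \<Longrightarrow> \<bar>partial_derivative i \<psi> x\<bar> \<le> B"
    using continuous_on_compact_bound[OF K(1) continuous_on_subset[OF D\<psi>_cont W(2)]] by auto
  obtain B1 where B1: "0 \<le> B1" "\<And>x. 0 \<le> \<sigma> x \<Longrightarrow> \<bar>\<phi> x\<bar> \<le> B1"
    using continuous_on_compact_bound[OF K(1) continuous_on_subset[OF \<phi>_cont W(2)]] by auto
  obtain B2 where B2: "0 \<le> B2" "\<And>x. 0 \<le> \<sigma> x \<Longrightarrow> \<bar>\<psi> x\<bar> \<le> B2"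
    using continuous_on_compact_bound[OF K(1) continuous_on_subset[OF \<psi>_cont W(2)]] by auto
  obtain R where R: "\<And>x. 0 \<le> \<sigma> x \<Longrightarrow> norm x \<le> R"
    using compact_imp_bounded[OF K(1)] unfolding bounded_iff by auto
  \<comment> \<open>A segment of length at most 1 starting at a point of norm at most
    \<open>R + 1\<close> stays in the ball of radius \<open>R + 2\<close>.\<close>
  obtain L where L: "0 \<le> L" "\<And>x. norm x \<le> R + 2 \<Longrightarrow> \<bar>partial_derivative i \<sigma> x\<bar> \<le> L"
    using continuous_on_compact_bound[OF compact_cball[of "0::real^'n" "R + 2"]
        polyfun_continuous_on[OF polyfun_partial_derivative[OF \<sigma>]]] by auto
  have mvt: "\<exists>z>0. z < t \<and> f (x + t *\<^sub>R e) - f x = t * partial_derivative i f (x + z *\<^sub>R e)"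
    if "0 < t" "\<And>z. 0 \<le> z \<Longrightarrow> z \<le> t \<Longrightarrow> f differentiable at (x + z *\<^sub>R e)" for f :: "real ^ 'n \<Rightarrow> real" and x t
    using MVT2[of 0 t "\<lambda>z. f (x + z *\<^sub>R e)" "\<lambda>z. partial_derivative i f (x + z *\<^sub>R e)"] that
      has_real_derivative_partial_derivative[of f x _ i] by (auto simp: e_def)
  have \<sigma>_lip: "\<bar>\<sigma> (x + t *\<^sub>R e) - \<sigma> x\<bar> \<le> L * t" if xt: "norm x \<le> R + 1" "0 < t" "t \<le> 1" for x t
  proof -
    obtain z where z: "0 < z" "z < t" "\<sigma> (x + t *\<^sub>R e) - \<sigma> x = t * partial_derivative i \<sigma> (x + z *\<^sub>R e)"
      using mvt[of t \<sigma> x] xt(2) \<sigma>_diff by blast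
    have "norm (x + z *\<^sub>R e) \<le> R + 2"
      using norm_triangle_ineq[of x "z *\<^sub>R e"] z xt norm_e by simp
    then show ?thesis
      using z xt mult_right_mono[OF L(2)[of "x + z *\<^sub>R e"], of t] by (simp add: abs_mult mult.commute)
  qed
  \<comment> \<open>\<open>B\<close> controls increments inside the set through the mean value
    theorem; \<open>B1 * L\<close> controls those that cross the boundary, where
    \<open>\<sigma>\<close> itself is at most \<open>L * t\<close>.\<close>
  define C where "C = B + B1 * L"
  have F_lip: "\<bar>F (x + t *\<^sub>R e) - F x\<bar> \<le> C * t * indicator (cball 0 (R + 1)) x"
    if t: "0 < t" "t \<le> 1" for x t
  proof (cases "norm x \<le> R + 1")
    \<comment> \<open>Both \<open>x\<close> and its translate have norm greater than
      \<open>R\<close>, so \<open>F\<close> vanishes at both.\<close>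
    case False
    have "norm x \<le> norm (x + t *\<^sub>R e) + 1"
      using norm_triangle_ineq4[of "x + t *\<^sub>R e" "t *\<^sub>R e"] t norm_e by simp
    then have "\<not> 0 < \<sigma> x" "\<not> 0 < \<sigma> (x + t *\<^sub>R e)"
      using R[of x] R[of "x + t *\<^sub>R e"] False by linarith+
    then show ?thesis using False by (simp add: F_def)
  next
    case True
    let ?y = "x + t *\<^sub>R e"
    note lip = \<sigma>_lip[OF True t]
    have le: "B1 * (L * t) \<le> C * t" "B * t \<le> C * t"
      using B(1) B1(1) L(1) t by (simp_all add: C_def distrib_right)
    have "\<bar>F ?y - F x\<bar> \<le> C * t"
    proof -
      consider (both) "0 < \<sigma> x" "0 < \<sigma> ?y" | (left) "0 < \<sigma> x" "\<sigma> ?y \<le> 0"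
        | (right) "\<sigma> x \<le> 0" "0 < \<sigma> ?y" | (neither) "\<sigma> x \<le> 0" "\<sigma> ?y \<le> 0" by linarith
      then show ?thesis
      proof cases
        case both
        \<comment> \<open>Convexity keeps the segment in the set, where \<open>\<psi>\<close> is
          differentiable and the bound \<open>B\<close> applies.\<close>
        have seg: "0 \<le> \<sigma> (x + z *\<^sub>R e)" if "0 \<le> z" "z \<le> t" for z
        proof -
          have "(1 - z / t) *\<^sub>R x + (z / t) *\<^sub>R ?y \<in> {x. 0 \<le> \<sigma> x}"
            using both that t by (intro convexD[OF K(2)]) auto
          moreover have "(1 - z / t) *\<^sub>R x + (z / t) *\<^sub>R ?y = x + z *\<^sub>R e"
            using t by (simp add: algebra_simps)
          ultimately show ?thesis by simp
        qed
        then obtain z where z: "0 < z" "z < t" "\<psi> ?y - \<psi> x = t * partial_derivative i \<psi> (x + z *\<^sub>R e)"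
          using mvt[of t \<psi> x] t \<psi>_diff W(2) by blast
        then have "\<bar>\<psi> ?y - \<psi> x\<bar> \<le> B * t"
          using t mult_right_mono[OF B(2)[OF seg[of z]], of t] by (simp add: abs_mult mult.commute)
        then show ?thesis using both le by (simp add: F_def)
      next
        case left
        \<comment> \<open>Since \<open>\<sigma> ?y \<le> 0\<close>, the positive number
          \<open>\<sigma> x\<close> is at most the increment bounded in \<open>lip\<close>.\<close>
        have "\<bar>\<sigma> x\<bar> * \<bar>\<phi> x\<bar> \<le> (L * t) * B1"
          using left lip B1 L t by (intro mult_mono) auto
        then show ?thesis using left le by (simp add: F_def \<psi>_def abs_mult mult.commute)
      next
        case right
        have "\<bar>\<sigma> ?y\<bar> * \<bar>\<phi> ?y\<bar> \<le> (L * t) * B1"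
          using right lip B1 L t by (intro mult_mono) auto
        then show ?thesis using right le by (simp add: F_def \<psi>_def abs_mult mult.commute)
      next
        case neither
        then show ?thesis using B(1) B1(1) L(1) t by (simp add: F_def C_def)
      qed
    qed
    then show ?thesis using True by simp
  qed
  have borelU: "{x. 0 < \<sigma> x} \<in> sets borel" using openU by simp
  have F_meas [measurable]: "F \<in> borel_measurable borel"
    using borel_measurable_continuous_on_indicator[OF borelU continuous_on_subset[OF \<psi>_cont U_W]]
    by (simp add: F_def indicator_def of_bool_def if_distrib[of "\<lambda>t. t * _"] cong: if_cong)
  have D_meas [measurable]: "D \<in> borel_measurable borel"
    using borel_measurable_continuous_on_indicator[OF borelU continuous_on_subset[OF D\<psi>_cont U_W]]
    by (simp add: D_def indicator_def of_bool_def if_distrib[of "\<lambda>t. t * _"] cong: if_cong)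
  have int_ball: "integrable lborel (\<lambda>x. c * indicator (cball 0 r) x :: real)" for c r and x :: "real ^ 'n"
    by (intro integrable_mult_right integrable_real_indicator)
       (use emeasure_lborel_cball_finite in auto)
  have F_int: "integrable lborel F"
  proof (rule Bochner_Integration.integrable_bound[OF int_ball])
    show "AE x in lborel. norm (F x) \<le> norm (B2 * indicator (cball 0 R) x)"
      using B2 R by (intro AE_I2) (auto simp: F_def less_imp_le)
  qed simp
  define Q where "Q = (\<lambda>n x. real (Suc n) * (F (x + (1 / real (Suc n)) *\<^sub>R e) - F x))"
  have Q_meas [measurable]: "Q n \<in> borel_measurable borel" for n unfolding Q_def by measurable
  have F_shift: "integrable lborel (\<lambda>x. F (x + c))" for c
  proof -
    have "integrable (distr lborel borel ((+) c)) F" using F_int by (simp add: lborel_distr_plus)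
    then show ?thesis by (subst (asm) integrable_distr_eq) (auto simp: add.commute)
  qed
  have Q_int: "integral\<^sup>L lborel (Q n) = 0" for n
    unfolding Q_def using F_int F_shift integral_translation_invariant[OF F_meas] by simp
  have "(\<lambda>n. integral\<^sup>L lborel (Q n)) \<longlonglongrightarrow> integral\<^sup>L lborel D"
  proof (rule integral_dominated_convergence)
    show "integrable lborel (\<lambda>x. C * indicator (cball 0 (R + 1)) x)" by (rule int_ball)
    show "AE x in lborel. norm (Q n x) \<le> C * indicator (cball 0 (R + 1)) x" for n
    proof (rule AE_I2)
      fix x
      have "\<bar>F (x + (1 / real (Suc n)) *\<^sub>R e) - F x\<bar> \<le> C * (1 / real (Suc n)) * indicator (cball 0 (R + 1)) x"
        by (rule F_lip) auto
      from mult_left_mono[OF this, of "real (Suc n)"]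
      show "norm (Q n x) \<le> C * indicator (cball 0 (R + 1)) x"
        by (simp add: Q_def abs_mult del: of_nat_Suc)
    qed
    have "closed {x. \<sigma> x = 0}" using \<sigma>_cont by (intro closed_Collect_eq continuous_intros)
    then have "{x. \<sigma> x = 0} \<in> null_sets lborel"
      using K(3) by (simp add: negligible_iff_null_sets null_sets_completion_iff)
    then have "AE x in lborel. \<sigma> x \<noteq> 0" by (rule AE_I') auto
    then show "AE x in lborel. (\<lambda>n. Q n x) \<longlonglongrightarrow> D x"
    proof (rule AE_mp, intro AE_I2 impI)
      fix x assume "\<sigma> x \<noteq> 0"
      \<comment> \<open>Near \<open>x\<close> the function \<open>F\<close> agrees either with
        \<open>\<psi>\<close> or with zero.\<close>
      then consider "0 < \<sigma> x" | "\<sigma> x < 0" by linarith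
      then have "F differentiable at x \<and> partial_derivative i F x = D x"
      proof cases
        case 1
        then have "F differentiable at x" "partial_derivative i F x = partial_derivative i \<psi> x"
          using differentiable_cong_open[OF openU, of x \<psi> F] \<psi>_diff[of x] U_W
            partial_derivative_cong_open[OF openU, of x F \<psi>] by (auto simp: F_def)
        then show ?thesis using 1 by (simp add: D_def)
      next
        case 2
        then have "F differentiable at x" "partial_derivative i F x = partial_derivative i (\<lambda>x. 0) x"
          using differentiable_cong_open[OF openL, of x "\<lambda>x. 0" F]
            partial_derivative_cong_open[OF openL, of x F "\<lambda>x. 0"] by (auto simp: F_def)
        then show ?thesis using 2 by (simp add: D_def partial_derivative_const)
      qed
      then show "(\<lambda>n. Q n x) \<longlonglongrightarrow> D x"
        using difference_quotient_tendsto[of F x i] by (simp add: Q_def e_def)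
    qed
  qed simp_all
  then have "integral\<^sup>L lborel D = 0" using Q_int by (simp add: LIMSEQ_const_iff)
  moreover have "integral\<^sup>L (lebesgue_on {x. 0 < \<sigma> x}) (partial_derivative i \<psi>) = integral\<^sup>L lborel D"
    using Lebesgue_Measure.integral_restrict_UNIV[of "{x. 0 < \<sigma> x}" "partial_derivative i \<psi>"]
      integral_completion[of D lborel] borelU D_meas by (simp add: D_def)
  ultimately show ?thesis by (simp add: \<psi>_def)
qed

section \<open>Green's formula for iterated Laplacians\<close>

lemma Ck_on_laplacian_power:
  assumes "open S" "Ck_on (k + 2 * m) S f"
  shows "Ck_on k S ((laplacian ^^ m) f)"
  using assms(2)
proof (induction m arbitrary: k)
  case (Suc m)
  then have "Ck_on (Suc (Suc k)) S ((laplacian ^^ m) f)" by (intro Suc.IH) (simp del: Ck_on.simps)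
  then show ?case using Ck_on_laplacian[OF assms(1)] by (simp del: Ck_on.simps)
qed simp

lemma integrable_on_open_subset_compact:
  fixes f :: "'a::euclidean_space \<Rightarrow> real"
  assumes "compact K" "continuous_on K f" "open U" "U \<subseteq> K"
  shows "integrable (lebesgue_on U) f"
proof -
  obtain B where B: "\<And>x. x \<in> K \<Longrightarrow> \<bar>f x\<bar> \<le> B"
    using continuous_on_compact_bound[OF assms(1,2)] by blast
  have "bounded U" using compact_imp_bounded[OF assms(1)] assms(4) by (rule bounded_subset)
  then have "U \<in> lmeasurable" using assms(3) by (rule lmeasurable_open)
  then interpret finite_measure "lebesgue_on U" by (rule finite_measure_lebesgue_on)
  have "f \<in> borel_measurable (lebesgue_on U)"
    using continuous_on_subset[OF assms(2,4)] assms(3)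
    by (intro continuous_imp_measurable_on_sets_lebesgue) auto
  then show ?thesis
    using assms(4) by (intro integrable_const_bound[of _ B]) (auto intro!: AE_I2 B)
qed

text \<open>\<open>W\<close> is where the second factor in Green's formula is smooth. The locale is
  used with \<open>s\<close> on \<open>UNIV\<close> for polynomials, and with \<open>s - c\<close>
  on the ellipsoid for functions that may be singular at its boundary.\<close>

locale superlevel_set =
  fixes \<sigma> :: "real ^ 'n \<Rightarrow> real" and W :: "(real ^ 'n) set"
  assumes level_polyfun: "polyfun 3 \<sigma>"
    and compact_superlevel: "compact {x. 0 \<le> \<sigma> x}"
    and convex_superlevel: "convex {x. 0 \<le> \<sigma> x}"
    and negligible_level: "negligible {x. \<sigma> x = 0}"
    and open_nhd: "open W"
    and superlevel_subset: "{x. 0 \<le> \<sigma> x} \<subseteq> W"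
begin

abbreviation "U \<equiv> {x. 0 < \<sigma> x}"

text \<open>Vanishing on the boundary is encoded as divisibility by \<open>\<sigma> ^ j\<close>
  among polynomials, so that orders can be counted with the product rule.\<close>

definition vanishing_order :: "nat \<Rightarrow> (real ^ 'n \<Rightarrow> real) \<Rightarrow> bool" where
  "vanishing_order j w \<longleftrightarrow> (\<exists>k q. polyfun k q \<and> w = (\<lambda>x. \<sigma> x ^ j * q x))"

lemma open_U: "open U"
  using polyfun_continuous_on[OF level_polyfun] by (intro open_Collect_less continuous_intros)

lemma integrable_on_U:
  fixes f :: "real ^ 'n \<Rightarrow> real"
  assumes "continuous_on W f"
  shows "integrable (lebesgue_on U) f"
  using continuous_on_subset[OF assms superlevel_subset] open_U
  by (rule integrable_on_open_subset_compact[OF compact_superlevel]) auto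

lemma vanishing_order_polyfun: "vanishing_order j w \<Longrightarrow> \<exists>k. polyfun k w"
  unfolding vanishing_order_def
  using polyfun_mult[OF polyfun_power[of 2 \<sigma> j]] level_polyfun by (auto simp: numeral_3_eq_3)

lemma vanishing_order_add:
  "vanishing_order j v \<Longrightarrow> vanishing_order j w \<Longrightarrow> vanishing_order j (\<lambda>x. v x + w x)"
proof -
  assume "vanishing_order j v" "vanishing_order j w"
  then obtain k q l r where "polyfun k q" "v = (\<lambda>x. \<sigma> x ^ j * q x)" "polyfun l r" "w = (\<lambda>x. \<sigma> x ^ j * r x)"
    unfolding vanishing_order_def by blast
  then show ?thesis
    unfolding vanishing_order_def
    by (intro exI[of _ "max k l"] exI[of _ "\<lambda>x. q x + r x"])
       (auto simp: distrib_left intro!: polyfun.add elim: polyfun_mono)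
qed

lemma vanishing_order_sum:
  "finite I \<Longrightarrow> (\<And>i. i \<in> I \<Longrightarrow> vanishing_order j (w i)) \<Longrightarrow> vanishing_order j (\<lambda>x. \<Sum>i\<in>I. w i x)"
proof (induction I rule: finite_induct)
  case empty
  show ?case unfolding vanishing_order_def using polyfun.zero by fastforce
qed (auto intro: vanishing_order_add)

text \<open>By the product rule, a derivative removes at most one factor
  \<open>\<sigma>\<close>.\<close>

lemma vanishing_order_partial_derivative:
  assumes "vanishing_order (Suc j) w"
  shows "vanishing_order j (partial_derivative i w)"
proof -
  obtain k q where q: "polyfun k q" and w: "w = (\<lambda>x. \<sigma> x ^ Suc j * q x)"
    using assms unfolding vanishing_order_def by blast
  note \<sigma> = level_polyfun
  have pow: "polyfun (Suc (2 * l)) (\<lambda>x. \<sigma> x ^ l)" for l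
    using polyfun_power[of 2 \<sigma> l] \<sigma> by (simp add: numeral_3_eq_3)
  have d_pow: "partial_derivative i (\<lambda>x. \<sigma> x ^ Suc l) =
      (\<lambda>x. real (Suc l) * \<sigma> x ^ l * partial_derivative i \<sigma> x)" for l
  proof (induction l)
    case (Suc l)
    show ?case
      using partial_derivative_mult[of \<sigma> _ "\<lambda>x. \<sigma> x ^ Suc l" i, unfolded Suc]
        polyfun_differentiable[OF \<sigma>] polyfun_differentiable[OF pow[of "Suc l"]]
      by (auto simp: fun_eq_iff algebra_simps)
  qed simp
  have "partial_derivative i w =
      (\<lambda>x. \<sigma> x ^ j * (\<sigma> x * partial_derivative i q x + real (Suc j) * (partial_derivative i \<sigma> x * q x)))"
    unfolding w
    using partial_derivative_mult[of "\<lambda>x. \<sigma> x ^ Suc j" _ q i, unfolded d_pow]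
      polyfun_differentiable[OF q] polyfun_differentiable[OF pow[of "Suc j"]]
    by (auto simp: fun_eq_iff algebra_simps)
  moreover have "polyfun (max (3 - 1 + (k - 1)) (3 - 1 - 1 + k))
      (\<lambda>x. \<sigma> x * partial_derivative i q x + real (Suc j) * (partial_derivative i \<sigma> x * q x))"
    by (rule polyfun.add; rule polyfun_mono)
       (auto intro!: polyfun_cmult polyfun_mult polyfun_partial_derivative \<sigma> q simp del: of_nat_Suc)
  ultimately show ?thesis unfolding vanishing_order_def by blast
qed

lemma vanishing_order_laplacian:
  "vanishing_order (Suc (Suc j)) w \<Longrightarrow> vanishing_order j (laplacian w)"
  unfolding laplacian_def by (intro vanishing_order_sum vanishing_order_partial_derivative) auto

text \<open>There is no boundary term because \<open>w\<close> contains a factor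
  \<open>\<sigma>\<close>.\<close>

lemma integration_by_parts:
  assumes w: "vanishing_order (Suc j) w" and h: "Ck_on 1 W h"
  shows "(\<integral>x. partial_derivative i w x * h x \<partial>lebesgue_on U) =
    - (\<integral>x. w x * partial_derivative i h x \<partial>lebesgue_on U)"
proof -
  obtain k q where q: "polyfun k q" and w_eq: "w = (\<lambda>x. \<sigma> x ^ Suc j * q x)"
    using w unfolding vanishing_order_def by blast
  \<comment> \<open>\<open>v\<close> is \<open>w\<close> with one factor \<open>\<sigma>\<close>
    split off, so that \<open>w * h\<close> takes the form \<open>\<sigma> * (v * h)\<close> handled
    by \<open>integral_partial_derivative_eq_0\<close>.\<close>
  define v where "v = (\<lambda>x. \<sigma> x ^ j * q x)"
  have "vanishing_order j v" unfolding vanishing_order_def v_def using q by blast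
  then obtain l where v: "polyfun l v" using vanishing_order_polyfun by blast
  obtain l' where w': "polyfun l' w" using vanishing_order_polyfun[OF w] by blast
  have h_diff: "h differentiable_on W" and h_cont: "continuous_on W (partial_derivative i h)"
    using h by auto
  have h_diff_at: "h differentiable at x" if "x \<in> W" for x
    using h_diff open_nhd that by (simp add: differentiable_on_eq_differentiable_at)
  have h_cont0: "continuous_on W h" using h_diff by (rule differentiable_imp_continuous_on)
  have d_vh: "partial_derivative i (\<lambda>x. v x * h x) x = v x * partial_derivative i h x + partial_derivative i v x * h x"
    if "x \<in> W" for x
    using that by (intro partial_derivative_mult polyfun_differentiable[OF v] h_diff_at)
  have d_wh: "partial_derivative i (\<lambda>x. w x * h x) x = w x * partial_derivative i h x + partial_derivative i w x * h x"
    if "x \<in> W" for x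
    using that by (intro partial_derivative_mult polyfun_differentiable[OF w'] h_diff_at)
  have "integral\<^sup>L (lebesgue_on U) (partial_derivative i (\<lambda>x. \<sigma> x * (v x * h x))) = 0"
  proof (rule integral_partial_derivative_eq_0[OF level_polyfun compact_superlevel
        convex_superlevel negligible_level open_nhd superlevel_subset])
    show "(\<lambda>x. v x * h x) differentiable_on W"
      using h_diff_at polyfun_differentiable[OF v] open_nhd
      by (auto simp: differentiable_on_eq_differentiable_at)
    have "continuous_on W (\<lambda>x. v x * partial_derivative i h x + partial_derivative i v x * h x)"
      using h_cont h_cont0 polyfun_continuous_on[OF v]
        polyfun_continuous_on[OF polyfun_partial_derivative[OF v]]
      by (intro continuous_intros)
    then show "continuous_on W (partial_derivative i (\<lambda>x. v x * h x))"
      by (rule continuous_on_eq) (simp add: d_vh)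
  qed
  moreover have "(\<lambda>x. \<sigma> x * (v x * h x)) = (\<lambda>x. w x * h x)"
    by (simp add: v_def w_eq algebra_simps)
  moreover have "integral\<^sup>L (lebesgue_on U) (partial_derivative i (\<lambda>x. w x * h x)) =
      (\<integral>x. w x * partial_derivative i h x + partial_derivative i w x * h x \<partial>lebesgue_on U)"
    using superlevel_subset by (intro Bochner_Integration.integral_cong refl d_wh) auto
  moreover have "\<dots> = (\<integral>x. w x * partial_derivative i h x \<partial>lebesgue_on U) +
      (\<integral>x. partial_derivative i w x * h x \<partial>lebesgue_on U)"
    using h_cont h_cont0 polyfun_continuous_on[OF w']
      polyfun_continuous_on[OF polyfun_partial_derivative[OF w']]
    by (intro Bochner_Integration.integral_add integrable_on_U continuous_intros)
  ultimately show ?thesis by simp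
qed

text \<open>Two integrations by parts in each coordinate. The first derivatives of \<open>w\<close>
  still vanish to order 1, so neither leaves a boundary term, and the two signs cancel.\<close>

lemma green_formula:
  assumes w: "vanishing_order 2 w" and h: "Ck_on 2 W h"
  shows "(\<integral>x. laplacian w x * h x \<partial>lebesgue_on U) = (\<integral>x. w x * laplacian h x \<partial>lebesgue_on U)"
proof -
  obtain k where k: "polyfun k w" using vanishing_order_polyfun[OF w] by blast
  have w1: "vanishing_order (Suc (Suc 0)) w" using w by (simp add: numeral_2_eq_2)
  have h1: "Ck_on 1 W h" "Ck_on 1 W (partial_derivative i h)" for i
    using h Ck_on_mono[OF h, of 1] by (simp_all add: numeral_2_eq_2 del: Ck_on.simps(1))
  have h2: "continuous_on W h" "continuous_on W (partial_derivative i (partial_derivative i h))" for i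
    using Ck_on_imp_continuous_on[OF h] h1(2)[of i] by simp_all
  have "(\<integral>x. laplacian w x * h x \<partial>lebesgue_on U) =
      (\<Sum>i\<in>UNIV. (\<integral>x. partial_derivative i (partial_derivative i w) x * h x \<partial>lebesgue_on U))"
    unfolding laplacian_def sum_distrib_right
    using h2 polyfun_continuous_on[OF polyfun_partial_derivative[OF polyfun_partial_derivative[OF k]]]
    by (intro Bochner_Integration.integral_sum integrable_on_U continuous_intros)
  also have "\<dots> = (\<Sum>i\<in>UNIV. (\<integral>x. w x * partial_derivative i (partial_derivative i h) x \<partial>lebesgue_on U))"
    using integration_by_parts[OF w1 h1(2)]
      integration_by_parts[OF vanishing_order_partial_derivative[OF w1] h1(1)] by simp
  also have "\<dots> = (\<integral>x. w x * laplacian h x \<partial>lebesgue_on U)"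
    unfolding laplacian_def sum_distrib_left
    using h2 polyfun_continuous_on[OF k]
    by (intro Bochner_Integration.integral_sum[symmetric] integrable_on_U continuous_intros)
  finally show ?thesis .
qed

text \<open>Induction with \<open>w\<close> arbitrary: the hypothesis is applied to
  \<open>laplacian w\<close>, which vanishes to order \<open>2 * m\<close>, and
  \<open>green_formula\<close> moves the remaining Laplacian onto
  \<open>(laplacian ^^ m) h\<close>.\<close>

lemma green_formula_power:
  assumes "vanishing_order (2 * m) w" and "Ck_on (2 * m) W h"
  shows "(\<integral>x. (laplacian ^^ m) w x * h x \<partial>lebesgue_on U) =
    (\<integral>x. w x * (laplacian ^^ m) h x \<partial>lebesgue_on U)"
  using assms
proof (induction m arbitrary: w)
  case (Suc m)
  have w: "vanishing_order (2 * m) (laplacian w)" "vanishing_order 2 w"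
  proof -
    show "vanishing_order (2 * m) (laplacian w)" using Suc.prems(1) by (intro vanishing_order_laplacian) simp
    obtain k q where q: "polyfun k q" and w_eq: "w = (\<lambda>x. \<sigma> x ^ (2 * Suc m) * q x)"
      using Suc.prems(1) unfolding vanishing_order_def by blast
    have "vanishing_order (2 * m) (\<lambda>x. \<sigma> x ^ (2 * m) * q x)"
      unfolding vanishing_order_def using q by blast
    then obtain l where "polyfun l (\<lambda>x. \<sigma> x ^ (2 * m) * q x)" using vanishing_order_polyfun by blast
    \<comment> \<open>The surplus powers of \<open>\<sigma>\<close> go into the polynomial
      cofactor.\<close>
    then show "vanishing_order 2 w"
      unfolding vanishing_order_def w_eq
      by (intro exI[of _ l] exI[of _ "\<lambda>x. \<sigma> x ^ (2 * m) * q x"]) (auto simp: power2_eq_square)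
  qed
  have h: "Ck_on (2 * m) W h" "Ck_on 2 W ((laplacian ^^ m) h)"
    using Ck_on_mono[OF Suc.prems(2), of "2 * m"] Suc.prems(2)
    by (auto intro!: Ck_on_laplacian_power[OF open_nhd] simp del: Ck_on.simps)
  have "(\<integral>x. (laplacian ^^ Suc m) w x * h x \<partial>lebesgue_on U) =
      (\<integral>x. laplacian w x * (laplacian ^^ m) h x \<partial>lebesgue_on U)"
    using Suc.IH[OF w(1) h(1)] by (simp add: funpow_swap1)
  also have "\<dots> = (\<integral>x. w x * (laplacian ^^ Suc m) h x \<partial>lebesgue_on U)"
    using green_formula[OF w(2) h(2)] by simp
  finally show ?case .
qed simp

end

section \<open>Orthogonal projections in \<open>L\<^sup>2\<close>\<close>

text \<open>The set where \<open>f\<close> is nonzero is null and open, hence empty.\<close>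

lemma continuous_nonneg_integral_0_imp_0:
  fixes f :: "'a::euclidean_space \<Rightarrow> real"
  assumes "open S" "continuous_on S f" "integrable (lebesgue_on S) f"
    and "\<And>x. x \<in> S \<Longrightarrow> 0 \<le> f x" "integral\<^sup>L (lebesgue_on S) f = 0" "x \<in> S"
  shows "f x = 0"
proof -
  have "AE x in lebesgue_on S. 0 \<le> f x" using assms(4) by (intro AE_I2) simp
  then have "AE x in lebesgue_on S. f x = 0"
    using assms(5) integral_nonneg_eq_0_iff_AE[OF assms(3)] by blast
  then have "AE x in lebesgue. x \<in> S \<longrightarrow> f x = 0"
    using assms(1) by (simp add: AE_restrict_space_iff)
  then have "negligible {x. \<not> (x \<in> S \<longrightarrow> f x = 0)}"
    by (simp add: negligible_iff_null_sets AE_iff_null_sets completion.AE_iff_null_sets)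
  moreover have "open {x \<in> S. f x \<in> - {0}}"
    using continuous_openin_preimage_gen[OF assms(2), of "- {0}"] assms(1)
    by (auto simp: openin_open_eq vimage_def Int_def)
  moreover have "{x. \<not> (x \<in> S \<longrightarrow> f x = 0)} = {x \<in> S. f x \<in> - {0}}" by auto
  ultimately show ?thesis using open_not_negligible assms(6) by fastforce
qed

lemma L2_on_mult_integrable:
  assumes "f \<in> L2_on S" "g \<in> L2_on S"
  shows "integrable (lebesgue_on S) (\<lambda>x. f x * g x)"
proof (rule Bochner_Integration.integrable_bound)
  show "integrable (lebesgue_on S) (\<lambda>x. (f x)\<^sup>2 + (g x)\<^sup>2)"
    using assms by (auto simp: L2_on_def)
  show "(\<lambda>x. f x * g x) \<in> borel_measurable (lebesgue_on S)"
    using assms by (auto simp: L2_on_def)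
  have "\<bar>a * b\<bar> \<le> \<bar>a\<^sup>2 + b\<^sup>2\<bar>" for a b :: real
  proof -
    have "2 * (\<bar>a\<bar> * \<bar>b\<bar>) \<le> a\<^sup>2 + b\<^sup>2" "0 \<le> \<bar>a\<bar> * \<bar>b\<bar>"
      using sum_squares_bound[of "\<bar>a\<bar>" "\<bar>b\<bar>"] by (simp_all add: mult.assoc)
    then show ?thesis unfolding abs_mult by linarith
  qed
  then show "AE x in lebesgue_on S. norm (f x * g x) \<le> norm ((f x)\<^sup>2 + (g x)\<^sup>2)" by simp
qed

text \<open>The measure is finite and \<open>\<bar>a\<bar> \<le> 1 + a\<^sup>2\<close>. This later
  supplies the dominating function for a limit of integrals.\<close>

lemma L2_on_integrable:
  assumes "bounded S" "open S" "f \<in> L2_on S"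
  shows "integrable (lebesgue_on S) f"
proof (rule Bochner_Integration.integrable_bound)
  interpret finite_measure "lebesgue_on S"
    using lmeasurable_open[OF assms(1,2)] by (rule finite_measure_lebesgue_on)
  show "integrable (lebesgue_on S) (\<lambda>x. 1 + (f x)\<^sup>2)"
    using assms by (auto simp: L2_on_def)
  show "f \<in> borel_measurable (lebesgue_on S)"
    using assms by (auto simp: L2_on_def)
  have "\<bar>a\<bar> \<le> \<bar>1 + a\<^sup>2\<bar>" for a :: real
    using sum_squares_bound[of 1 "\<bar>a\<bar>"] by simp
  then show "AE x in lebesgue_on S. norm (f x) \<le> norm (1 + (f x)\<^sup>2)" by simp
qed

lemma continuous_integrable_bounded_open:
  fixes f :: "'a::euclidean_space \<Rightarrow> real"
  assumes "bounded S" "open S" "continuous_on UNIV f"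
  shows "integrable (lebesgue_on S) f"
  using assms closure_subset
  by (intro integrable_on_open_subset_compact[of "closure S"]) (auto intro: continuous_on_subset)

lemma polyfun_restrict_L2:
  assumes "bounded S" "open S" "polyfun k p"
  shows "restrict p S \<in> L2_on S"
proof -
  have cont: "continuous_on T p" for T using assms(3) by (rule polyfun_continuous_on)
  have "p \<in> borel_measurable (lebesgue_on S)"
    using cont assms(2) by (intro continuous_imp_measurable_on_sets_lebesgue) auto
  then have "restrict p S \<in> borel_measurable (lebesgue_on S)"
    by (subst measurable_cong[of _ _ p]) auto
  moreover have "integrable (lebesgue_on S) (\<lambda>x. (p x)\<^sup>2)"
    using cont by (intro continuous_integrable_bounded_open assms continuous_intros)
  then have "integrable (lebesgue_on S) (\<lambda>x. (restrict p S x)\<^sup>2)"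
    by (subst Bochner_Integration.integrable_cong[OF refl, of _ _ "\<lambda>x. (p x)\<^sup>2"]) auto
  ultimately show ?thesis by (simp add: L2_on_def)
qed

text \<open>Two candidates for the projection differ by a function of norm zero; continuity turns
  this into equality on \<open>S\<close>, and extensionality settles the points outside.\<close>

lemma bergman_projection_eqI:
  assumes S: "open S" and f: "f \<in> L2_on S" and g: "g \<in> polyharmonic_L2 m S"
    and orth: "\<And>h. h \<in> polyharmonic_L2 m S \<Longrightarrow> L2_inner S (\<lambda>x. f x - g x) h = 0"
  shows "bergman_projection m S f = g"
  unfolding bergman_projection_def
proof (rule the_equality)
  fix g' assume g': "g' \<in> polyharmonic_L2 m S \<and> (\<forall>h\<in>polyharmonic_L2 m S. L2_inner S (\<lambda>x. f x - g' x) h = 0)"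
  have L2: "g \<in> L2_on S" "g' \<in> L2_on S" using g g' by (auto simp: polyharmonic_L2_def)
  note int = L2_on_mult_integrable
  have lin: "(\<integral>x. (A x - B x) - (B x - C x) \<partial>M) =
      (integral\<^sup>L M A - integral\<^sup>L M B) - (integral\<^sup>L M B - integral\<^sup>L M C)"
    if "integrable M A" "integrable M B" "integrable M C"
    for M :: "(real ^ 'n) measure" and A B C :: "real ^ 'n \<Rightarrow> real"
    using that by simp
  have diff: "L2_inner S (\<lambda>x. u x - v x) w = L2_inner S u w - L2_inner S v w"
    if "u \<in> L2_on S" "v \<in> L2_on S" "w \<in> L2_on S" for u v w
    unfolding L2_inner_def left_diff_distrib using int that
    by (intro Bochner_Integration.integral_diff) auto
  have cont: "continuous_on S g" "continuous_on S g'"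
    using g g' Ck_on_imp_continuous_on by (auto simp: polyharmonic_L2_def polyharmonic_on_def)
  \<comment> \<open>\<open>g' - g\<close> need not be extensional, hence need not lie in
    \<open>polyharmonic_L2\<close>, so its squared norm is expanded into inner products to which the
    orthogonality relations apply.\<close>
  have eq: "(\<lambda>x. (g' x - g x)\<^sup>2) = (\<lambda>x. (g' x * g' x - g' x * g x) - (g' x * g x - g x * g x))"
    by (auto simp: power2_eq_square algebra_simps)
  have comm: "L2_inner S g g' = L2_inner S g' g" by (simp add: L2_inner_def mult.commute)
  have "L2_inner S f g = L2_inner S g g" "L2_inner S f g' = L2_inner S g g'"
    using orth[OF g] orth[of g'] g' diff f L2 by auto
  moreover have "L2_inner S f g = L2_inner S g' g" "L2_inner S f g' = L2_inner S g' g'"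
    using g g' diff f L2 by auto
  moreover have "integral\<^sup>L (lebesgue_on S) (\<lambda>x. (g' x - g x)\<^sup>2) =
      (L2_inner S g' g' - L2_inner S g' g) - (L2_inner S g' g - L2_inner S g g)"
    unfolding eq L2_inner_def using L2 by (intro lin int)
  ultimately have int0: "integral\<^sup>L (lebesgue_on S) (\<lambda>x. (g' x - g x)\<^sup>2) = 0" using comm by simp
  have int_sq: "integrable (lebesgue_on S) (\<lambda>x. (g' x - g x)\<^sup>2)"
    unfolding eq using L2 by (intro Bochner_Integration.integrable_diff int)
  have "(g' x - g x)\<^sup>2 = 0" if "x \<in> S" for x
    by (rule continuous_nonneg_integral_0_imp_0[OF S _ _ _ int0 that])
       (use cont int_sq in \<open>auto intro!: continuous_intros\<close>)
  then show "g' = g"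
    using L2 by (intro extensionalityI[of _ S]) (auto simp: L2_on_def)
qed (use g orth in auto)

text \<open>Gram-Schmidt by induction on the index set; the family \<open>w\<close> may be linearly
  dependent.\<close>

lemma finite_projection:
  fixes w :: "'i \<Rightarrow> real ^ 'n \<Rightarrow> real"
  assumes S: "bounded S" "open S"
    and "finite I" "\<And>i. i \<in> I \<Longrightarrow> polyfun k (w i)" "polyfun k f"
  obtains c where "\<And>j. j \<in> I \<Longrightarrow> L2_inner S (\<lambda>x. f x - (\<Sum>i\<in>I. c i * w i x)) (w j) = 0"
proof -
  have cont: "continuous_on UNIV u" if "polyfun k u" for u :: "real ^ 'n \<Rightarrow> real"
    using that by (rule polyfun_continuous_on)
  have int: "integrable (lebesgue_on S) (\<lambda>x. u x * v x)" if "polyfun k u" "polyfun k v" for u v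
    using that cont by (intro continuous_integrable_bounded_open S continuous_intros) auto
  have diff: "L2_inner S (\<lambda>x. u x - t * v x) z = L2_inner S u z - t * L2_inner S v z"
    if "polyfun k u" "polyfun k v" "polyfun k z" for u v z t
    unfolding L2_inner_def left_diff_distrib mult.assoc using int that by simp
  have add: "L2_inner S z (\<lambda>x. v x + (\<Sum>i\<in>J. a i * u i x)) = L2_inner S z v + (\<Sum>i\<in>J. a i * L2_inner S z (u i))"
    if v: "polyfun k v" and J: "finite J" and u: "\<And>i. i \<in> J \<Longrightarrow> polyfun k (u i)" and z: "polyfun k z"
    for u :: "'i \<Rightarrow> real ^ 'n \<Rightarrow> real" and v z a J
  proof -
    have "integrable (lebesgue_on S) (\<lambda>x. z x * (a i * u i x))" if "i \<in> J" for i
      using int[OF z polyfun_cmult[OF u[OF that], of "a i"]] .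
    then show ?thesis
      unfolding L2_inner_def distrib_left sum_distrib_left
      using int[OF z v] J by (simp add: mult.left_commute[of "z _"])
  qed
  have "\<exists>c. \<forall>j\<in>I. L2_inner S (\<lambda>x. f x - (\<Sum>i\<in>I. c i * w i x)) (w j) = 0"
    using assms(3-5)
  proof (induction I arbitrary: f rule: finite_induct)
    case (insert l I)
    have wl: "polyfun k (w l)" and wI: "\<And>i. i \<in> I \<Longrightarrow> polyfun k (w i)" using insert.prems by auto
    obtain a where a: "\<forall>j\<in>I. L2_inner S (\<lambda>x. w l x - (\<Sum>i\<in>I. a i * w i x)) (w j) = 0"
      using insert.IH[OF wI wl] by blast
    obtain b where b: "\<forall>j\<in>I. L2_inner S (\<lambda>x. f x - (\<Sum>i\<in>I. b i * w i x)) (w j) = 0"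
      using insert.IH[OF wI insert.prems(2)] by blast
    \<comment> \<open>\<open>r\<close> and \<open>p\<close> are the residuals of \<open>w l\<close>
      and \<open>f\<close> with respect to the earlier functions; only the component of
      \<open>p\<close> along \<open>r\<close> remains to be removed.\<close>
    define r where "r = (\<lambda>x. w l x - (\<Sum>i\<in>I. a i * w i x))"
    define p where "p = (\<lambda>x. f x - (\<Sum>i\<in>I. b i * w i x))"
    have r: "polyfun k r" and p: "polyfun k p"
      unfolding r_def p_def using wI wl insert.prems(2) insert.hyps(1)
      by (auto intro!: polyfun_diff polyfun_sum polyfun_cmult)
    define t where "t = L2_inner S p r / L2_inner S r r"
    have t: "L2_inner S p r = t * L2_inner S r r"
    proof (cases "L2_inner S r r = 0")
      \<comment> \<open>A residual of norm zero vanishes on \<open>S\<close>, so both sides are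
        zero.\<close>
      case True
      have "r x * r x = 0" if "x \<in> S" for x
        by (rule continuous_nonneg_integral_0_imp_0[OF S(2) _ int[OF r r] _ True[unfolded L2_inner_def] that])
           (use polyfun_continuous_on[OF r] in \<open>auto intro!: continuous_intros\<close>)
      then have "L2_inner S p r = integral\<^sup>L (lebesgue_on S) (\<lambda>x. 0)"
        unfolding L2_inner_def by (intro Bochner_Integration.integral_cong) auto
      then show ?thesis using True by simp
    qed (simp add: t_def)
    \<comment> \<open>These coefficients come from expanding \<open>p - t * r\<close>.\<close>
    define c where "c = (\<lambda>i. if i = l then t else b i - t * a i)"
    have res: "(\<lambda>x. f x - (\<Sum>i\<in>insert l I. c i * w i x)) = (\<lambda>x. p x - t * r x)"
    proof
      fix x
      have "(\<Sum>i\<in>I. c i * w i x) = (\<Sum>i\<in>I. b i * w i x - t * (a i * w i x))"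
        using insert.hyps by (intro sum.cong) (auto simp: c_def algebra_simps)
      then show "f x - (\<Sum>i\<in>insert l I. c i * w i x) = p x - t * r x"
        using insert.hyps
        by (simp add: p_def r_def c_def[THEN fun_cong, of l] sum_subtractf sum_distrib_left[symmetric] algebra_simps)
    qed
    have pr: "polyfun k (\<lambda>x. p x - t * r x)" using p r by (intro polyfun_diff polyfun_cmult)
    have orthI: "L2_inner S (\<lambda>x. p x - t * r x) (w j) = 0" if "j \<in> I" for j
      using a b that diff[OF p r wI[OF that]] by (simp add: p_def r_def)
    have "w l = (\<lambda>x. r x + (\<Sum>i\<in>I. a i * w i x))" by (simp add: r_def)
    then have "L2_inner S (\<lambda>x. p x - t * r x) (w l) = 0"
      using add[where a = a, OF r insert.hyps(1) wI pr] diff[OF p r r, of t] orthI t by simp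
    then show ?case using orthI by (intro exI[of _ c]) (simp add: res)
  qed simp
  with that show thesis by blast
qed

section \<open>Ellipsoids as superlevel sets of quadratic polynomials\<close>

lemma ellipsoid_polyfun:
  fixes E :: "(real ^ 'n) set"
  assumes "ellipsoid E"
  obtains s where "polyfun 3 s" "E = {x. 0 < s x}"
    "\<And>c. 0 \<le> c \<Longrightarrow> c < 1 \<Longrightarrow> compact {x. c \<le> s x} \<and> convex {x. c \<le> s x} \<and> negligible {x. s x = c}"
proof -
  obtain A :: "real ^ 'n ^ 'n" and b where A: "invertible A" and E: "E = (\<lambda>x. A *v x + b) ` ball 0 1"
    using assms unfolding ellipsoid_def by blast
  obtain M where inv: "A ** M = mat 1" "M ** A = mat 1"
    using A unfolding invertible_def by blast
  \<comment> \<open>\<open>M\<close> inverts \<open>A\<close>, so in the coordinate \<open>y\<close>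
    of the unit ball \<open>s\<close> becomes \<open>1 - (norm y)\<^sup>2\<close>.\<close>
  define s where "s = (\<lambda>x. 1 - (norm (M *v (x - b)))\<^sup>2)"
  have s_A: "s (A *v y + b) = 1 - (norm y)\<^sup>2" for y
    by (simp add: s_def matrix_vector_mul_assoc inv)
  have surj: "x = A *v (M *v (x - b)) + b" for x
    by (simp add: matrix_vector_mul_assoc inv)
  have level: "{x. P (s x)} = (\<lambda>x. A *v x + b) ` {y. P (1 - (norm y)\<^sup>2)}" for P
    using surj s_A by (auto simp: image_iff) metis
  have M_polyfun: "polyfun 2 (\<lambda>x. (M *v (x - b)) $ i)" for i
    unfolding matrix_vector_mult_def
    using polyfun.var[OF polyfun.const[of 0 1]] polyfun.const[of 1]
    by (auto intro!: polyfun_sum polyfun_cmult polyfun_diff simp: numeral_2_eq_2)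
  have "polyfun 3 (\<lambda>x. \<Sum>i\<in>UNIV. (M *v (x - b)) $ i * (M *v (x - b)) $ i)"
    using polyfun_mult[OF M_polyfun M_polyfun] by (intro polyfun_sum) (simp_all add: numeral_3_eq_3)
  then have "polyfun 3 s"
    unfolding s_def power2_norm_eq_inner inner_vec_def inner_real_def
    using polyfun.const[of 2 1] by (intro polyfun_diff) (auto simp: numeral_3_eq_3)
  moreover have "E = {x. 0 < s x}"
    unfolding level E by (rule arg_cong[where f = "image _"]) (auto simp: power_less_one_iff abs_square_less_1)
  \<comment> \<open>Level \<open>c\<close> corresponds to radius \<open>sqrt (1 - c)\<close> in the
    unit ball. Level 0 gives the closed ellipsoid, and the positive levels give smaller ones that
    exhaust \<open>E\<close>.\<close>
  moreover have "compact {x. c \<le> s x} \<and> convex {x. c \<le> s x} \<and> negligible {x. s x = c}"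
    if "0 \<le> c" "c < 1" for c
  proof -
    have le: "c \<le> 1 - (norm y)\<^sup>2 \<longleftrightarrow> norm y \<le> sqrt (1 - c)" for y :: "real ^ 'n"
      using real_le_rsqrt[of "norm y" "1 - c"] sqrt_ge_absD[of "norm y" "1 - c"] by auto
    have eq: "1 - (norm y)\<^sup>2 = c \<longleftrightarrow> norm y = sqrt (1 - c)" for y :: "real ^ 'n"
      using that by (auto simp: real_sqrt_unique)
    have "{x. c \<le> s x} = (\<lambda>x. A *v x + b) ` cball 0 (sqrt (1 - c))"
      unfolding level by (simp add: le cball_def)
    then have 1: "{x. c \<le> s x} = (+) b ` ((*v) A ` cball 0 (sqrt (1 - c)))"
      by (simp add: image_image add.commute)
    have "{x. s x = c} = (\<lambda>x. A *v x + b) ` sphere 0 (sqrt (1 - c))"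
      unfolding level[of "\<lambda>t. t = c"] by (simp add: eq sphere_def)
    then have 2: "{x. s x = c} = (+) b ` ((*v) A ` sphere 0 (sqrt (1 - c)))"
      by (simp add: image_image add.commute)
    have lin: "linear ((*v) A)" by (rule matrix_vector_mul_linear)
    have "negligible ((*v) A ` sphere 0 (sqrt (1 - c)))"
      by (rule negligible_differentiable_image_negligible[OF order_refl negligible_sphere
            linear_imp_differentiable_on[OF lin]])
    moreover have "compact ((*v) A ` cball 0 (sqrt (1 - c)))"
      by (intro compact_continuous_image linear_continuous_on[OF linear_conv_bounded_linear[THEN iffD1, OF lin]]
          compact_cball)
    moreover have "convex ((*v) A ` cball 0 (sqrt (1 - c)))"
      by (intro convex_linear_image lin convex_cball)
    ultimately show ?thesis
      unfolding 1 2 by (intro conjI compact_translation convex_translation negligible_translation)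
  qed
  ultimately show thesis using that by blast
qed

section \<open>The projection of a polynomial\<close>

text \<open>A square-integrable \<open>g\<close> may blow up at the boundary, so Green's formula is applied to
  \<open>s - c\<close> on \<open>{s > c}\<close>, where \<open>g\<close> is smooth up to the boundary, and then \<open>c\<close> tends to 0.\<close>

lemma laplacian_power_vanishing_orthogonal:
  fixes s :: "real ^ 'n \<Rightarrow> real"
  assumes s: "polyfun 3 s"
    and level: "\<And>c. 0 \<le> c \<Longrightarrow> c < 1 \<Longrightarrow> compact {x. c \<le> s x} \<and> convex {x. c \<le> s x} \<and> negligible {x. s x = c}"
    and q: "polyfun k q" and g: "g \<in> polyharmonic_L2 m {x. 0 < s x}"
  shows "L2_inner {x. 0 < s x} ((laplacian ^^ m) (\<lambda>x. s x ^ (2 * m) * q x)) g = 0"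
proof -
  define E where "E = {x. 0 < s x}"
  have cont_s: "continuous_on S s" for S using s by (rule polyfun_continuous_on)
  have E: "open E" unfolding E_def using cont_s by (intro open_Collect_less continuous_intros)
  have bdd: "bounded E"
    using compact_imp_bounded[of "{x. 0 \<le> s x}"] level[of 0] unfolding E_def
    by (auto elim: bounded_subset)
  have gL2: "g \<in> L2_on E" and g_poly: "Ck_on (2 * m) E g" "\<And>x. x \<in> E \<Longrightarrow> (laplacian ^^ m) g x = 0"
    using g by (auto simp: polyharmonic_L2_def polyharmonic_on_def E_def)
  have g_int: "integrable (lebesgue_on E) g" using L2_on_integrable[OF bdd E gL2] .
  define G where "G = (\<lambda>c. (laplacian ^^ m) (\<lambda>x. (s x - c) ^ (2 * m) * q x))"
  define T where "T = (\<lambda>j. (laplacian ^^ m) (\<lambda>x. s x ^ j * q x))"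
  define K where "K = Suc (2 * (2 * m)) + k"
  have pow: "polyfun K (\<lambda>x. s x ^ j * q x)" if "j \<le> 2 * m" for j
  proof -
    have "polyfun (Suc (2 * j)) (\<lambda>x. s x ^ j)" using polyfun_power[of 2 s j] s by (simp add: numeral_3_eq_3)
    from polyfun_mult[OF this q] show ?thesis
      by (rule polyfun_mono) (use that in \<open>simp add: K_def\<close>)
  qed
  have T_cont: "continuous_on S (T j)" if "j \<le> 2 * m" for j S
    unfolding T_def using polyfun_laplacian_power[OF pow[OF that]] by (rule polyfun_continuous_on)
  have G_eq: "G c = (\<lambda>x. \<Sum>j\<le>2 * m. (real ((2 * m) choose j) * (- c) ^ (2 * m - j)) * T j x)" for c
  proof -
    have "(s x - c) ^ (2 * m) * q x =
        (\<Sum>j\<le>2 * m. (real ((2 * m) choose j) * (- c) ^ (2 * m - j)) * (s x ^ j * q x))" for x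
      using binomial_ring[of "s x" "- c" "2 * m"] by (simp add: sum_distrib_left mult_ac)
    then show ?thesis
      unfolding G_def T_def using laplacian_power_sum[of "{..2 * m}" K "\<lambda>j x. s x ^ j * q x"] pow by simp
  qed
  define c where "c = (\<lambda>n. 1 / real (n + 2))"
  have c: "0 < c n" "c n < 1" for n by (auto simp: c_def)
  have c_lim: "c \<longlonglongrightarrow> 0"
    unfolding c_def using LIMSEQ_ignore_initial_segment[OF lim_1_over_n, of 2] by simp
  have G_lim: "(\<lambda>n. G (c n) x) \<longlonglongrightarrow> G 0 x" for x
    unfolding G_eq using c_lim by (intro tendsto_intros)
  define H where "H = (\<lambda>x. \<Sum>j\<le>2 * m. real ((2 * m) choose j) * \<bar>T j x\<bar>)"
  have H_cont: "continuous_on S H" for S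
    unfolding H_def using T_cont by (intro continuous_intros) auto
  obtain B where B: "0 \<le> B" "\<And>x. x \<in> {x. 0 \<le> s x} \<Longrightarrow> \<bar>H x\<bar> \<le> B"
    using continuous_on_compact_bound[of "{x. 0 \<le> s x}" H] level[of 0] H_cont by auto
  have G_bound: "\<bar>G (c n) x\<bar> \<le> B" if "x \<in> E" for n x
  proof -
    have "\<bar>G (c n) x\<bar> \<le> (\<Sum>j\<le>2 * m. \<bar>(real ((2 * m) choose j) * (- c n) ^ (2 * m - j)) * T j x\<bar>)"
      unfolding G_eq by (rule sum_abs)
    also have "\<dots> \<le> H x"
      unfolding H_def
    proof (rule sum_mono)
      fix j
      have "\<bar>c n\<bar> ^ (2 * m - j) \<le> 1" using c[of n] by (intro power_le_one) auto
      then show "\<bar>(real ((2 * m) choose j) * (- c n) ^ (2 * m - j)) * T j x\<bar> \<le> real ((2 * m) choose j) * \<bar>T j x\<bar>"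
        by (simp add: abs_mult power_abs mult_left_le mult_right_mono)
    qed
    also have "\<dots> \<le> B" using B(2)[of x] that by (auto simp: E_def)
    finally show ?thesis .
  qed
  define f where "f = (\<lambda>n x. if x \<in> {x. 0 < s x - c n} then G (c n) x * g x else 0)"
  have openU: "open {x. 0 < s x - a}" for a
    using cont_s by (intro open_Collect_less continuous_intros)
  have U_E: "{x. 0 < s x - c n} \<subseteq> E" for n using c[of n] unfolding E_def by auto
  have f_int: "integral\<^sup>L (lebesgue_on E) (f n) = 0" for n
  proof -
    have level_n: "{x. 0 \<le> s x - c n} = {x. c n \<le> s x}" "{x. s x - c n = 0} = {x. s x = c n}" by auto
    interpret superlevel_set "\<lambda>x. s x - c n" E
    proof
      show "polyfun 3 (\<lambda>x. s x - c n)"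
        using s polyfun.const[of 2 "c n"] by (intro polyfun_diff) (simp_all add: numeral_3_eq_3)
      show "{x. 0 \<le> s x - c n} \<subseteq> E" using c[of n] by (auto simp: E_def)
    qed (unfold level_n, use level[of "c n"] c[of n] E in auto)
    have w: "vanishing_order (2 * m) (\<lambda>x. (s x - c n) ^ (2 * m) * q x)"
      unfolding vanishing_order_def using q by blast
    have "integral\<^sup>L (lebesgue_on E) (f n) = (\<integral>x. G (c n) x * g x \<partial>lebesgue_on {x. 0 < s x - c n})"
      unfolding f_def using U_E[of n] openU[of "c n"] E by (intro integral_restrict) auto
    also have "\<dots> = (\<integral>x. (s x - c n) ^ (2 * m) * q x * (laplacian ^^ m) g x \<partial>lebesgue_on {x. 0 < s x - c n})"
      unfolding G_def using green_formula_power[OF w g_poly(1)] by simp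
    also have "\<dots> = (\<integral>x. 0 \<partial>lebesgue_on {x. 0 < s x - c n})"
      using U_E[of n] g_poly(2) by (intro Bochner_Integration.integral_cong) auto
    finally show ?thesis by simp
  qed
  have g_meas [measurable]: "g \<in> borel_measurable (lebesgue_on E)"
    using g_int by (rule borel_measurable_integrable)
  have s_meas [measurable]: "s \<in> borel_measurable (lebesgue_on E)"
    using cont_s E by (intro continuous_imp_measurable_on_sets_lebesgue) auto
  have G_meas [measurable]: "G a \<in> borel_measurable (lebesgue_on E)" for a
    unfolding G_eq using T_cont E
    by (intro continuous_imp_measurable_on_sets_lebesgue continuous_intros) auto
  have "(\<lambda>n. integral\<^sup>L (lebesgue_on E) (f n)) \<longlonglongrightarrow> (\<integral>x. G 0 x * g x \<partial>lebesgue_on E)"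
  proof (rule integral_dominated_convergence)
    show "integrable (lebesgue_on E) (\<lambda>x. B * \<bar>g x\<bar>)" using g_int by simp
    show "(\<lambda>x. G 0 x * g x) \<in> borel_measurable (lebesgue_on E)" by measurable
    show "f n \<in> borel_measurable (lebesgue_on E)" for n unfolding f_def mem_Collect_eq by measurable
    show "AE x in lebesgue_on E. norm (f n x) \<le> B * \<bar>g x\<bar>" for n
      using G_bound B(1) by (intro AE_I2) (auto simp: f_def abs_mult intro!: mult_right_mono)
    show "AE x in lebesgue_on E. (\<lambda>n. f n x) \<longlonglongrightarrow> G 0 x * g x"
    proof (rule AE_I2)
      fix x assume "x \<in> space (lebesgue_on E)"
      then have "0 < s x" by (simp add: E_def)
      then have "eventually (\<lambda>n. c n < s x) sequentially" using c_lim by (rule order_tendstoD(2)[rotated])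
      then have "eventually (\<lambda>n. G (c n) x * g x = f n x) sequentially"
        by eventually_elim (simp add: f_def)
      moreover have "(\<lambda>n. G (c n) x * g x) \<longlonglongrightarrow> G 0 x * g x" by (intro tendsto_intros G_lim)
      ultimately show "(\<lambda>n. f n x) \<longlonglongrightarrow> G 0 x * g x" by (rule Lim_transform_eventually[rotated])
    qed
  qed
  then have "(\<integral>x. G 0 x * g x \<partial>lebesgue_on E) = 0" using f_int by (simp add: LIMSEQ_const_iff)
  then show ?thesis by (simp add: L2_inner_def E_def G_def)
qed

lemma polyharmonic_projection_exists:
  fixes E :: "(real ^ 'n) set"
  assumes "ellipsoid E" "polyfun (Suc N) p"
  obtains h where "polyfun (Suc N) h" "polyharmonic_on m E h"
    "\<And>g. g \<in> polyharmonic_L2 m E \<Longrightarrow> L2_inner E (\<lambda>x. p x - h x) g = 0"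
proof -
  obtain s where s: "polyfun 3 s" and E: "E = {x. 0 < s x}"
    and level: "\<And>c. 0 \<le> c \<Longrightarrow> c < 1 \<Longrightarrow> compact {x. c \<le> s x} \<and> convex {x. c \<le> s x} \<and> negligible {x. s x = c}"
    using ellipsoid_polyfun[OF assms(1)] by metis
  interpret superlevel_set s UNIV by unfold_locales (use s level[of 0] in auto)
  have bdd: "bounded E"
    using compact_imp_bounded[OF compact_superlevel] unfolding E by (rule bounded_subset) auto
  have opn: "open E" using open_U E by simp
  define k where "k = Suc N - 2 * m"
  define J where "J = {\<alpha> :: 'n \<Rightarrow> nat. (\<Sum>i\<in>UNIV. \<alpha> i) < k}"
  define M where "M = (\<lambda>\<alpha> (x :: real ^ 'n). \<Prod>i\<in>UNIV. (x $ i) ^ \<alpha> i)"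
  define w where "w = (\<lambda>\<alpha>. (laplacian ^^ m) (\<lambda>x. s x ^ (2 * m) * M \<alpha> x))"
  have fin: "finite J" unfolding J_def by (rule finite_multi_indices_less)
  have M: "polyfun k (M \<alpha>)" if "\<alpha> \<in> J" for \<alpha>
    unfolding M_def using that by (intro polyfun_mono[OF polyfun_monomial]) (simp add: J_def)
  have sM: "polyfun (2 * (2 * m) + k) (\<lambda>x. s x ^ (2 * m) * M \<alpha> x)" if "\<alpha> \<in> J" for \<alpha>
    using polyfun_mult[OF polyfun_power[of 2 s "2 * m"] M[OF that]] s by (simp add: numeral_3_eq_3)
  have w: "polyfun (Suc N) (w \<alpha>)" if "\<alpha> \<in> J" for \<alpha>
  proof -
    have "0 < k" using that by (auto simp: J_def)
    then show ?thesis
      unfolding w_def by (intro polyfun_mono[OF polyfun_laplacian_power[OF sM[OF that]]]) (simp add: k_def)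
  qed
  have w_sum: "(laplacian ^^ m) (\<lambda>x. s x ^ (2 * m) * (\<Sum>\<alpha>\<in>J. a \<alpha> * M \<alpha> x)) = (\<lambda>x. \<Sum>\<alpha>\<in>J. a \<alpha> * w \<alpha> x)" for a
    using laplacian_power_sum[where m = m and a = a, OF fin sM] by (simp add: w_def sum_distrib_left mult.left_commute)
  obtain a where a: "\<And>\<beta>. \<beta> \<in> J \<Longrightarrow> L2_inner E (\<lambda>x. p x - (\<Sum>\<alpha>\<in>J. a \<alpha> * w \<alpha> x)) (w \<beta>) = 0"
    using finite_projection[where w = w, OF bdd opn fin w assms(2)] by blast
  define h where "h = (\<lambda>x. p x - (\<Sum>\<alpha>\<in>J. a \<alpha> * w \<alpha> x))"
  have h: "polyfun (Suc N) h"
    unfolding h_def using fin w assms(2) by (intro polyfun_diff polyfun_sum polyfun_cmult) auto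
  have "polyfun k ((laplacian ^^ m) h)" unfolding k_def using h by (rule polyfun_laplacian_power)
  then obtain d where d: "(laplacian ^^ m) h = (\<lambda>x. \<Sum>\<alpha>\<in>J. d \<alpha> * M \<alpha> x)"
    unfolding J_def M_def by (rule polyfun_expansion)
  let ?r = "(laplacian ^^ m) h"
  have cont: "continuous_on UNIV u" if "polyfun l u" for l u using that by (rule polyfun_continuous_on)
  have "vanishing_order (2 * m) (\<lambda>x. s x ^ (2 * m) * ?r x)"
    unfolding vanishing_order_def using polyfun_laplacian_power[OF h] by blast
  note green = green_formula_power[OF this polyfun_Ck_on[OF h]]
  have "(laplacian ^^ m) (\<lambda>x. s x ^ (2 * m) * ?r x) = (\<lambda>x. \<Sum>\<alpha>\<in>J. d \<alpha> * w \<alpha> x)"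
    unfolding d by (rule w_sum)
  with green
  have "(\<integral>x. s x ^ (2 * m) * ?r x * ?r x \<partial>lebesgue_on E) = (\<integral>x. (\<Sum>\<alpha>\<in>J. d \<alpha> * w \<alpha> x) * h x \<partial>lebesgue_on E)"
    unfolding E by simp
  also have "\<dots> = (\<Sum>\<alpha>\<in>J. d \<alpha> * L2_inner E h (w \<alpha>))"
  proof -
    have "integrable (lebesgue_on E) (\<lambda>x. h x * w \<alpha> x)" if "\<alpha> \<in> J" for \<alpha>
      using cont[OF h] cont[OF w[OF that]]
      by (intro continuous_integrable_bounded_open bdd opn continuous_intros)
    then show ?thesis
      by (simp add: L2_inner_def sum_distrib_right mult.assoc mult.commute[of "w _ _"])
  qed
  also have "\<dots> = 0" using a by (simp add: h_def)
  finally have int0: "(\<integral>x. s x ^ (2 * m) * ?r x * ?r x \<partial>lebesgue_on E) = 0" .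
  have r0: "?r x = 0" if "x \<in> E" for x
  proof -
    have c: "continuous_on UNIV (\<lambda>x. s x ^ (2 * m) * ?r x * ?r x)"
      using cont[OF s] cont[OF polyfun_laplacian_power[OF h]] by (intro continuous_intros)
    have "s x ^ (2 * m) * ?r x * ?r x = 0"
      by (rule continuous_nonneg_integral_0_imp_0[OF opn continuous_on_subset[OF c]
            continuous_integrable_bounded_open[OF bdd opn c] _ int0 that])
         (auto simp: E mult.assoc)
    then show ?thesis using that by (simp add: E)
  qed
  show thesis
  proof
    show "polyfun (Suc N) h" by (rule h)
    show "polyharmonic_on m E h" unfolding polyharmonic_on_def using r0 polyfun_Ck_on[OF h] by blast
    fix g assume g: "g \<in> polyharmonic_L2 m E"
    have "polyfun k (\<lambda>x. \<Sum>\<alpha>\<in>J. a \<alpha> * M \<alpha> x)" using M fin by (intro polyfun_sum polyfun_cmult)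
    from laplacian_power_vanishing_orthogonal[OF s level this, of g m]
    show "L2_inner E (\<lambda>x. p x - h x) g = 0" using g w_sum[of a] by (simp add: E h_def)
  qed
qed

theorem theorem5p1:
  fixes E :: "(real ^ 'n) set" and m N :: nat
  assumes "ellipsoid E" and "0 < m" and "0 < N"
  shows "bergman_projection m E ` polynomials_on N E = polyharmonic_polynomials_on m N E"
proof -
  obtain s :: "real ^ 'n \<Rightarrow> real" where s: "polyfun 3 s" and E: "E = {x. 0 < s x}"
    and level: "\<And>c. 0 \<le> c \<Longrightarrow> c < 1 \<Longrightarrow> compact {x. c \<le> s x} \<and> convex {x. c \<le> s x} \<and> negligible {x. s x = c}"
    using ellipsoid_polyfun[OF assms(1)] by metis
  have opn: "open E"
    unfolding E using polyfun_continuous_on[OF s] by (intro open_Collect_less continuous_intros)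
  have bdd: "bounded E"
    using compact_imp_bounded[of "{x. 0 \<le> s x}"] level[of 0] unfolding E by (auto elim: bounded_subset)
  have poly_L2: "f \<in> L2_on E" if "f \<in> polynomials_on N E" for f
    using that polyfun_restrict_L2[OF bdd opn]
    by (auto simp: polynomials_on_def polynomial_deg_le_iff_polyfun)
  have "bergman_projection m E f \<in> polyharmonic_polynomials_on m N E" if f: "f \<in> polynomials_on N E" for f
  proof -
    obtain p where p: "f = restrict p E" "polyfun (Suc N) p"
      using f by (auto simp: polynomials_on_def polynomial_deg_le_iff_polyfun)
    obtain h where h: "polyfun (Suc N) h" "polyharmonic_on m E h"
      and orth: "\<And>g. g \<in> polyharmonic_L2 m E \<Longrightarrow> L2_inner E (\<lambda>x. p x - h x) g = 0"
      using polyharmonic_projection_exists[OF assms(1) p(2)] by blast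
    have h': "polyharmonic_on m E (restrict h E)"
      using opn _ h(2) by (rule polyharmonic_on_cong) simp
    have "bergman_projection m E f = restrict h E"
    proof (rule bergman_projection_eqI[OF opn poly_L2[OF f]])
      show "restrict h E \<in> polyharmonic_L2 m E"
        using h' polyfun_restrict_L2[OF bdd opn h(1)] by (simp add: polyharmonic_L2_def)
      fix g assume "g \<in> polyharmonic_L2 m E"
      moreover have "L2_inner E (\<lambda>x. f x - restrict h E x) g = L2_inner E (\<lambda>x. p x - h x) g"
        unfolding L2_inner_def p(1) by (intro Bochner_Integration.integral_cong) auto
      ultimately show "L2_inner E (\<lambda>x. f x - restrict h E x) g = 0" using orth by simp
    qed
    then show ?thesis
      using h(1) h' by (auto simp: polyharmonic_polynomials_on_def polynomials_on_def
          polynomial_deg_le_iff_polyfun)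
  qed
  moreover have "f \<in> bergman_projection m E ` polynomials_on N E"
    if "f \<in> polyharmonic_polynomials_on m N E" for f
  proof -
    have f: "f \<in> polynomials_on N E" "polyharmonic_on m E f"
      using that by (auto simp: polyharmonic_polynomials_on_def)
    then have "bergman_projection m E f = f"
      using poly_L2 by (intro bergman_projection_eqI opn) (auto simp: polyharmonic_L2_def L2_inner_def)
    then show ?thesis using f(1) by force
  qed
  ultimately show ?thesis by blast
qed

end
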